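(* Let $\mathscr G=(X,\mathcal L)$ be an interval greedoid of rank $m=\mathrm{rk}(\mathscr G)$, let $1\le k<m$, and let $q:\mathcal L\to\mathbb R_{>0}$ be a $k$-admissible weight function with a scale sequence $(c_0,\dots,c_m)\in\mathbb R_{>0}^{m+1}$. Then the following are equivalent: (a) $\mathrm L_q(k)^2=\mathrm L_q(k-1)\cdot\mathrm L_q(k+1)$. (b) There is $s>0$ such that for every $\alpha\in\mathcal L$ with $|\alpha|=k-1$: $\ \mathrm L_{q,\alpha}(2)=s\,\mathrm L_{q,\alpha}(1)=s^2\,\mathrm L_{q,\alpha}(0)$. (c) There is $s>0$ such that for every $\alpha\in\mathcal L$ with $|\alpha|=k-1$: $$\sum_{x\in\mathrm{Cont}(\alpha)}\frac{q(\alpha x)}{q(\alpha)}=s,\qquad\text{and}\qquad \bigl(1-b_\alpha(\mathcal C)\bigr)\sum_{x\in\mathcal C}\frac{q(\alpha x)}{q(\alpha)}=s\Bigl(1-\frac{c_k^2}{c_{k-1}c_{k+1}}\Bigr)\ \text{ for all }\mathcal C\in\mathrm{Par}(\alpha).$$ Here $\mathrm L_q(j)=\sum_{\alpha\in\mathcal L,\,|\alpha|=j}q(\alpha)$ and $\mathrm L_{q,\alpha}(j)=\sum_{\beta\in\mathrm{Cont}_j(\alpha)}q(\alpha\beta)$.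
   Context: **Greedoids.** Let $X$ be a finite set, $X^*$ the set of finite words in $X$; a word is simple if no letter repeats; $|\alpha|$ is the length of $\alpha$. A greedoid is a pair $\mathscr G=(X,\mathcal L)$ with $\mathcal L\subset X^*$ finite such that: the empty word is in $\mathcal L$; every $\alpha\in\mathcal L$ is simple; $\alpha\beta\in\mathcal L\Rightarrow\alpha\in\mathcal L$; and if $\alpha,\beta\in\mathcal L$ with $|\alpha|>|\beta|$ then there is a letter $x$ of $\alpha$ with $\beta x\in\mathcal L$. $\mathrm{rk}(\mathscr G)=\max\{|\alpha|:\alpha\in\mathcal L\}$. It is an interval greedoid if moreover for all $\alpha,\beta,\gamma\in X^*$, $x\in X$: $\alpha x,\ \alpha\beta\gamma x\in\mathcal L\Rightarrow\alpha\beta x\in\mathcal L$. **Notation.** For $\alpha\in\mathcal L$: $\mathrm{Cont}_r(\alpha)=\{\beta\in X^*:|\beta|=r,\ \alpha\beta\in\mathcal L\}$, $\mathrm{Cont}(\alpha)=\mathrm{Cont}_1(\alpha)$ (and these sets are empty if $\alpha\notin\mathcal L$). On $\mathrm{Cont}(\alpha)$ the relation $x\sim_\alpha y\iff\alpha xy\notin\mathcal L$ is an equivalence relation; $\mathrm{Par}(\alpha)$ is the set of its classes. For $x\in\mathrm{Cont}(\alpha)$, $\mathrm{Des}_\alpha(x)=\{y\in X:\alpha xy\in\mathcal L,\ \alpha y\notin\mathcal L\}$. For $x,y\in X$, $\mathrm{Pas}_\alpha(x,y)=\{z\in X:\alpha z\notin\mathcal L,\ \alpha xz\notin\mathcal L,\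 \alpha yz\notin\mathcal L,\ \alpha xyz\in\mathcal L\}$, $\mathrm{Act}_\alpha(x,y)=\{z\in X:\alpha z\notin\mathcal L,\ \alpha xz\in\mathcal L,\ \alpha yz\in\mathcal L,\ \alpha xyz\in\mathcal L\}$. **$k$-admissible.** Extend $q:\mathcal L\to\mathbb R_{>0}$ to $X^*$ by $0$ outside $\mathcal L$. $q$ is $k$-admissible with scale sequence $(c_0,\dots,c_m)\in\mathbb R_{>0}^{m+1}$ if, with $\omega(\alpha):=q(\alpha)/c_{|\alpha|}$, the following hold for every $\alpha\in\mathcal L$ with $\ell:=|\alpha|<k$: 1. (ContInv) $q(\alpha xy\beta)=q(\alpha yx\beta)$ for all $x,y\in\mathrm{Cont}(\alpha)$, $\beta\in X^*$. 2. (PAMon) for all distinct $x,y\in\mathrm{Cont}(\alpha)$ and all $r\ge0$: $\sum_{z\in\mathrm{Pas}_\alpha(x,y)}\sum_{\beta\in\mathrm{Cont}_r(\alpha xyz)}q(\alpha xyz\beta)\ \ge\ \sum_{z\in\mathrm{Act}_\alpha(x,y)}\sum_{\beta\in\mathrm{Cont}_r(\alpha xyz)}q(\alpha xyz\beta)$. 3. (LogMod) $\omega(\alpha x)\,\omega(\alpha y)=\omega(\alpha)\,\omega(\alpha xy)$ for all $x,y\in\mathrm{Cont}(\alpha)$ with $\alpha xy\in\mathcal L$. 4. (FewDes) for every $\mathcal C\in\mathrm{Par}(\alpha)$ with $|\mathcal C|\ge2$ and every $x\in\mathcal C$: $\mathrm{Des}_\alpha(x)=\varnothing$. 5. (SynMon)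 $\omega(\alpha x)^2\ge\sum_{y\in\mathrm{Des}_\alpha(x)}\omega(\alpha)\,\omega(\alpha xy)$ for all $x\in\mathrm{Cont}(\alpha)$. 6. (ScaleMon) $\Bigl(1-\frac{c_{\ell+1}^2}{c_\ell c_{\ell+2}}\Bigr)\sum_{\mathcal C\in\mathrm{Par}(\alpha)}\frac{1}{1-b_\alpha(\mathcal C)}\le1$, where $b_\alpha(\mathcal C)=\sum_{y\in\mathrm{Des}_\alpha(x)}\frac{\omega(\alpha)\omega(\alpha xy)}{\omega(\alpha x)^2}$ if $\mathcal C=\{x\}$ and $b_\alpha(\mathcal C)=0$ if $|\mathcal C|\ge2$. Convention: this is considered satisfied whenever $c_{\ell+1}^2\ge c_\ell c_{\ell+2}$; and when $c_{\ell+1}^2<c_\ell c_{\ell+2}$ it includes the requirement $b_\alpha(\mathcal C)<1$ for all $\mathcal C\in\mathrm{Par}(\alpha)$. The quantity $b_\alpha(\mathcal C)$ in the claim is the one defined in item 6. *)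

theory Defs
  imports Complex_Main
begin

text \<open>Words over \<open>X\<close> are elements of \<open>lists X\<close>; a word is simple iff it is \<open>distinct\<close>.\<close>

locale greedoid =
  fixes X :: "'a set" and L :: "'a list set"
  assumes finite_ground: "finite X"
    and words: "L \<subseteq> lists X"
    and finite_language: "finite L"
    and empty_word: "[] \<in> L"
    and simple: "\<alpha> \<in> L \<Longrightarrow> distinct \<alpha>"
    and hereditary: "\<alpha> @ \<beta> \<in> L \<Longrightarrow> \<alpha> \<in> L"
    and exchange: "\<lbrakk>\<alpha> \<in> L; \<beta> \<in> L; length \<alpha> > length \<beta>\<rbrakk> \<Longrightarrow> \<exists>x\<in>set \<alpha>. \<beta> @ [x] \<in> L"

locale interval_greedoid = greedoid X L for X :: "'a set" and L :: "'a list set" +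
  assumes interval:
    "\<lbrakk>\<alpha> \<in> lists X; \<beta> \<in> lists X; \<gamma> \<in> lists X; x \<in> X;
      \<alpha> @ [x] \<in> L; \<alpha> @ \<beta> @ \<gamma> @ [x] \<in> L\<rbrakk> \<Longrightarrow> \<alpha> @ \<beta> @ [x] \<in> L"

definition rk :: "'a list set \<Rightarrow> nat" where
  "rk L = Max (length ` L)"

definition Cont_words :: "'a set \<Rightarrow> 'a list set \<Rightarrow> nat \<Rightarrow> 'a list \<Rightarrow> 'a list set" where
  "Cont_words X L r \<alpha> = {\<beta> \<in> lists X. \<alpha> \<in> L \<and> length \<beta> = r \<and> \<alpha> @ \<beta> \<in> L}"

text \<open>The one-letter continuations, with words of length 1 identified with letters.\<close>

definition Cont :: "'a set \<Rightarrow> 'a list set \<Rightarrow> 'a list \<Rightarrow> 'a set" where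
  "Cont X L \<alpha> = {x. [x] \<in> Cont_words X L 1 \<alpha>}"

definition par_rel :: "'a set \<Rightarrow> 'a list set \<Rightarrow> 'a list \<Rightarrow> ('a \<times> 'a) set" where
  "par_rel X L \<alpha> = {(x, y). x \<in> Cont X L \<alpha> \<and> y \<in> Cont X L \<alpha> \<and> \<alpha> @ [x, y] \<notin> L}"

definition Par :: "'a set \<Rightarrow> 'a list set \<Rightarrow> 'a list \<Rightarrow> 'a set set" where
  "Par X L \<alpha> = Cont X L \<alpha> // par_rel X L \<alpha>"

definition Des :: "'a set \<Rightarrow> 'a list set \<Rightarrow> 'a list \<Rightarrow> 'a \<Rightarrow> 'a set" where
  "Des X L \<alpha> x = {y \<in> X. \<alpha> @ [x, y] \<in> L \<and> \<alpha> @ [y] \<notin> L}"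

definition Pas :: "'a set \<Rightarrow> 'a list set \<Rightarrow> 'a list \<Rightarrow> 'a \<Rightarrow> 'a \<Rightarrow> 'a set" where
  "Pas X L \<alpha> x y = {z \<in> X. \<alpha> @ [z] \<notin> L \<and> \<alpha> @ [x, z] \<notin> L \<and> \<alpha> @ [y, z] \<notin> L \<and> \<alpha> @ [x, y, z] \<in> L}"

definition Act :: "'a set \<Rightarrow> 'a list set \<Rightarrow> 'a list \<Rightarrow> 'a \<Rightarrow> 'a \<Rightarrow> 'a set" where
  "Act X L \<alpha> x y = {z \<in> X. \<alpha> @ [z] \<notin> L \<and> \<alpha> @ [x, z] \<in> L \<and> \<alpha> @ [y, z] \<in> L \<and> \<alpha> @ [x, y, z] \<in> L}"

text \<open>A positive weight on \<open>L\<close>, given directly through its extension by zero to all words.\<close>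

definition weight_function :: "'a list set \<Rightarrow> ('a list \<Rightarrow> real) \<Rightarrow> bool" where
  "weight_function L q \<longleftrightarrow> (\<forall>\<alpha>\<in>L. q \<alpha> > 0) \<and> (\<forall>\<alpha>. \<alpha> \<notin> L \<longrightarrow> q \<alpha> = 0)"

text \<open>A scale sequence \<open>(c\<^sub>0, \<dots>, c\<^sub>m)\<close>, where \<open>m\<close> is the rank, is a function on \<open>nat\<close> whose values
  beyond \<open>m\<close> carry no meaning: they are never used below when the level \<open>k\<close> is less than \<open>m\<close>.\<close>

definition scale_sequence :: "'a list set \<Rightarrow> (nat \<Rightarrow> real) \<Rightarrow> bool" where
  "scale_sequence L c \<longleftrightarrow> (\<forall>i\<le>rk L. c i > 0)"

definition scaled :: "('a list \<Rightarrow> real) \<Rightarrow> (nat \<Rightarrow> real) \<Rightarrow> 'a list \<Rightarrow> real" where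
  "scaled q c \<alpha> = q \<alpha> / c (length \<alpha>)"

definition par_coeff ::
    "'a set \<Rightarrow> 'a list set \<Rightarrow> ('a list \<Rightarrow> real) \<Rightarrow> (nat \<Rightarrow> real) \<Rightarrow> 'a list \<Rightarrow> 'a set \<Rightarrow> real" where
  "par_coeff X L q c \<alpha> C =
     (if is_singleton C
      then let x = the_elem C in
        \<Sum>y\<in>Des X L \<alpha> x. scaled q c \<alpha> * scaled q c (\<alpha> @ [x, y]) / (scaled q c (\<alpha> @ [x]))\<^sup>2
      else 0)"

definition ContInv where
  "ContInv X L (q :: 'a list \<Rightarrow> real) \<alpha> \<longleftrightarrow>
     (\<forall>x\<in>Cont X L \<alpha>. \<forall>y\<in>Cont X L \<alpha>. \<forall>\<beta>\<in>lists X. q (\<alpha> @ [x, y] @ \<beta>) = q (\<alpha> @ [y, x] @ \<beta>))"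

definition PAMon where
  "PAMon X L (q :: 'a list \<Rightarrow> real) \<alpha> \<longleftrightarrow>
     (\<forall>x\<in>Cont X L \<alpha>. \<forall>y\<in>Cont X L \<alpha>. x \<noteq> y \<longrightarrow> (\<forall>r.
        (\<Sum>z\<in>Pas X L \<alpha> x y. \<Sum>\<beta>\<in>Cont_words X L r (\<alpha> @ [x, y, z]). q (\<alpha> @ [x, y, z] @ \<beta>)) \<ge>
        (\<Sum>z\<in>Act X L \<alpha> x y. \<Sum>\<beta>\<in>Cont_words X L r (\<alpha> @ [x, y, z]). q (\<alpha> @ [x, y, z] @ \<beta>))))"

definition LogMod where
  "LogMod X L (q :: 'a list \<Rightarrow> real) c \<alpha> \<longleftrightarrow>
     (\<forall>x\<in>Cont X L \<alpha>. \<forall>y\<in>Cont X L \<alpha>. \<alpha> @ [x, y] \<in> L \<longrightarrow>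
        scaled q c (\<alpha> @ [x]) * scaled q c (\<alpha> @ [y]) = scaled q c \<alpha> * scaled q c (\<alpha> @ [x, y]))"

definition FewDes where
  "FewDes X L \<alpha> \<longleftrightarrow> (\<forall>C\<in>Par X L \<alpha>. card C \<ge> 2 \<longrightarrow> (\<forall>x\<in>C. Des X L \<alpha> x = {}))"

definition SynMon where
  "SynMon X L (q :: 'a list \<Rightarrow> real) c \<alpha> \<longleftrightarrow>
     (\<forall>x\<in>Cont X L \<alpha>.
        (scaled q c (\<alpha> @ [x]))\<^sup>2 \<ge> (\<Sum>y\<in>Des X L \<alpha> x. scaled q c \<alpha> * scaled q c (\<alpha> @ [x, y])))"

text \<open>The condition is void when \<open>c\<close> is log-concave at the level in question; otherwise it includes
  that every denominator is positive.\<close>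

definition ScaleMon where
  "ScaleMon X L (q :: 'a list \<Rightarrow> real) c \<alpha> \<longleftrightarrow>
     (let l = length \<alpha> in
        (c (l + 1))\<^sup>2 < c l * c (l + 2) \<longrightarrow>
          (\<forall>C\<in>Par X L \<alpha>. par_coeff X L q c \<alpha> C < 1) \<and>
          (1 - (c (l + 1))\<^sup>2 / (c l * c (l + 2))) *
            (\<Sum>C\<in>Par X L \<alpha>. 1 / (1 - par_coeff X L q c \<alpha> C)) \<le> 1)"

definition admissible ::
    "'a set \<Rightarrow> 'a list set \<Rightarrow> nat \<Rightarrow> ('a list \<Rightarrow> real) \<Rightarrow> (nat \<Rightarrow> real) \<Rightarrow> bool" where
  "admissible X L k q c \<longleftrightarrow>
     weight_function L q \<and> scale_sequence L c \<and>
     (\<forall>\<alpha>\<in>L. length \<alpha> < k \<longrightarrow>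
        ContInv X L q \<alpha> \<and> PAMon X L q \<alpha> \<and> LogMod X L q c \<alpha> \<and>
        FewDes X L \<alpha> \<and> SynMon X L q c \<alpha> \<and> ScaleMon X L q c \<alpha>)"

definition level_sum :: "'a list set \<Rightarrow> ('a list \<Rightarrow> real) \<Rightarrow> nat \<Rightarrow> real" where
  "level_sum L q j = (\<Sum>\<alpha> | \<alpha> \<in> L \<and> length \<alpha> = j. q \<alpha>)"

definition cont_level_sum ::
    "'a set \<Rightarrow> 'a list set \<Rightarrow> ('a list \<Rightarrow> real) \<Rightarrow> 'a list \<Rightarrow> nat \<Rightarrow> real" where
  "cont_level_sum X L q \<alpha> j = (\<Sum>\<beta>\<in>Cont_words X L j \<alpha>. q (\<alpha> @ \<beta>))"

lemma (in greedoid) equiv_par_rel: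
  "equiv (Cont X L \<alpha>) (par_rel X L \<alpha>)"
proof -
  have dist: "\<alpha> @ [x, x] \<notin> L" for x
    using simple by fastforce
  have step: "\<alpha> @ [y, x] \<in> L \<or> \<alpha> @ [y, z] \<in> L"
    if ext: "\<alpha> @ [x, z] \<in> L" "\<alpha> @ [y] \<in> L" for x y z
  proof -
    obtain w where w: "w \<in> set (\<alpha> @ [x, z])" "(\<alpha> @ [y]) @ [w] \<in> L"
      using exchange[of "\<alpha> @ [x, z]" "\<alpha> @ [y]"] ext by auto
    then have "w \<notin> set \<alpha>" using simple[OF w(2)] by auto
    with w show ?thesis by auto
  qed
  show ?thesis
  proof (rule equivI)
    show "par_rel X L \<alpha> \<subseteq> Cont X L \<alpha> \<times> Cont X L \<alpha>"
      by (auto simp: par_rel_def)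
    show "refl_on (Cont X L \<alpha>) (par_rel X L \<alpha>)"
      using dist by (auto simp: refl_on_def par_rel_def)
    show "sym (par_rel X L \<alpha>)"
      unfolding sym_def par_rel_def Cont_def Cont_words_def using step dist by blast
    show "trans (par_rel X L \<alpha>)"
      unfolding trans_def par_rel_def Cont_def Cont_words_def using step dist by blast
  qed
qed

end

theory Submission
  imports Defs "HOL-Analysis.Function_Topology" "HOL-Analysis.Convex"
begin

text \<open>To every \<open>\<alpha> \<in> L\<close> and \<open>n\<close> one attaches a symmetric matrix \<open>A(\<alpha>, n)\<close>, indexed by the
  one-letter continuations of \<open>\<alpha>\<close> and one extra index, whose quadratic form takes the values
  \<open>L\<^sub>\<alpha>(n+2)\<close>, \<open>L\<^sub>\<alpha>(n+1)\<close>, \<open>L\<^sub>\<alpha>(n)\<close> on the indicator \<open>f\<close> of the letters and the indicator \<open>g\<close> of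
  the extra index (combinatorial atlas of Chan and Pak). The conditions LogMod, FewDes, SynMon and
  ScaleMon make \<open>A(\<alpha>, 0)\<close> hyperbolic (at most one positive eigenvalue). The rows of
  \<open>t A(\<alpha>, n+1) + (1-t) A(\<alpha>, n)\<close> are read off from the forms of \<open>A(\<alpha>x, n)\<close> and \<open>A(\<alpha>, n)\<close>, and
  with PAMon these forms dominate that of the matrix itself, so hyperbolicity propagates.

  Equality in (a) says that \<open>z = f - s g\<close> is isotropic and orthogonal to \<open>g\<close>, hence lies in the
  kernel of \<open>A([], k-1)\<close>. Tracing the propagation argument backwards, \<open>z\<close> is then isotropic for
  every \<open>A(\<alpha>x, n)\<close> as well, down to \<open>A(\<alpha>, 0)\<close> with \<open>|\<alpha>| = k-1\<close>, where the kernel equations are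
  exactly (c).\<close>

section \<open>Hyperbolic quadratic forms\<close>

definition mv :: "'i set \<Rightarrow> ('i \<Rightarrow> 'i \<Rightarrow> real) \<Rightarrow> ('i \<Rightarrow> real) \<Rightarrow> 'i \<Rightarrow> real" where
  "mv I M v i = (\<Sum>j\<in>I. M i j * v j)"

definition bil :: "'i set \<Rightarrow> ('i \<Rightarrow> 'i \<Rightarrow> real) \<Rightarrow> ('i \<Rightarrow> real) \<Rightarrow> ('i \<Rightarrow> real) \<Rightarrow> real" where
  "bil I M v w = (\<Sum>i\<in>I. v i * mv I M w i)"

definition symmetric_on :: "'i set \<Rightarrow> ('i \<Rightarrow> 'i \<Rightarrow> real) \<Rightarrow> bool" where
  "symmetric_on I M \<longleftrightarrow> (\<forall>i\<in>I. \<forall>j\<in>I. M i j = M j i)"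

text \<open>The reversed Cauchy-Schwarz inequality stands in for the eigenvalue condition: it
  applies directly to given vectors and passes to limits.\<close>

definition hyperbolic :: "'i set \<Rightarrow> ('i \<Rightarrow> 'i \<Rightarrow> real) \<Rightarrow> bool" where
  "hyperbolic I M \<longleftrightarrow>
     (\<forall>v w. bil I M w w > 0 \<longrightarrow> bil I M v v * bil I M w w \<le> (bil I M v w)\<^sup>2)"

lemma mv_linear:
  "mv I M (\<lambda>i. a * v i + b * w i) i = a * mv I M v i + b * mv I M w i"
  by (simp add: mv_def algebra_simps sum.distrib sum_distrib_left)

lemma bil_linear_left:
  "bil I M (\<lambda>i. a * v i + b * w i) u = a * bil I M v u + b * bil I M w u"
  by (simp add: bil_def algebra_simps sum.distrib sum_distrib_left)

lemma bil_linear_right: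
  "bil I M u (\<lambda>i. a * v i + b * w i) = a * bil I M u v + b * bil I M u w"
  by (simp add: bil_def mv_linear algebra_simps sum.distrib sum_distrib_left)

lemma bil_commute:
  assumes "symmetric_on I M"
  shows "bil I M v w = bil I M w v"
proof -
  have "bil I M v w = (\<Sum>i\<in>I. \<Sum>j\<in>I. M i j * v i * w j)"
    by (simp add: bil_def mv_def sum_distrib_left mult_ac)
  also have "\<dots> = (\<Sum>j\<in>I. \<Sum>i\<in>I. M i j * v i * w j)"
    by (rule sum.swap)
  also have "\<dots> = (\<Sum>j\<in>I. \<Sum>i\<in>I. M j i * v i * w j)"
    using assms by (intro sum.cong refl) (auto simp: symmetric_on_def)
  also have "\<dots> = bil I M w v"
    by (simp add: bil_def mv_def sum_distrib_left mult_ac)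
  finally show ?thesis .
qed

lemma bil_cong:
  assumes "\<And>i. i \<in> I \<Longrightarrow> v i = v' i" "\<And>i. i \<in> I \<Longrightarrow> w i = w' i"
  shows "bil I M v w = bil I M v' w'"
  using assms by (simp add: bil_def mv_def)

lemma mv_matrix_linear:
  "mv I (\<lambda>i j. a * M i j + b * M' i j) v i = a * mv I M v i + b * mv I M' v i"
  by (simp add: mv_def algebra_simps sum.distrib sum_distrib_left)

lemma bil_matrix_linear:
  "bil I (\<lambda>i j. a * M i j + b * M' i j) v w = a * bil I M v w + b * bil I M' v w"
  by (simp add: bil_def mv_matrix_linear algebra_simps sum.distrib sum_distrib_left)

text \<open>For small \<open>t\<close> of the sign opposite to \<open>p\<close> the linear term
  would outweigh the quadratic one.\<close>

lemma linear_coeff_zero: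
  fixes p r :: real
  assumes "\<And>t. 0 \<le> 2 * t * p + t\<^sup>2 * r"
  shows "p = 0"
proof (rule ccontr)
  assume "p \<noteq> 0"
  define e where "e = 1 / (\<bar>r\<bar> + 1)"
  have e: "e > 0" "e * \<bar>r\<bar> < 1" by (auto simp: e_def field_simps)
  have "0 \<le> 2 * (- e * p) * p + (- e * p)\<^sup>2 * r" by (rule assms)
  also have "\<dots> = e * p\<^sup>2 * (e * r - 2)" by (simp add: power2_eq_square algebra_simps)
  finally have "0 \<le> e * r - 2" using e \<open>p \<noteq> 0\<close>
    by (simp add: zero_le_mult_iff mult_le_0_iff)
  moreover have "e * r \<le> e * \<bar>r\<bar>" using e by (intro mult_left_mono) auto
  ultimately show False using e by linarith
qed

lemma bil_quadratic:
  assumes "symmetric_on I M"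
  shows "bil I M (\<lambda>i. a * v i + b * w i) (\<lambda>i. a * v i + b * w i) =
    a\<^sup>2 * bil I M v v + 2 * a * b * bil I M v w + b\<^sup>2 * bil I M w w"
  using bil_commute[OF assms, of w v]
  by (simp add: bil_linear_left bil_linear_right power2_eq_square algebra_simps)

text \<open>Subtracting from \<open>v\<close> the multiple of \<open>w\<close> that makes it
  orthogonal to \<open>h\<close> gives a quadratic polynomial in \<open>t\<close> with a nonpositive
  value; completing the square yields the claim.\<close>

lemma hyperbolic_of_neg_semidef:
  assumes S: "symmetric_on I M"
    and nsd: "\<And>v. bil I M v h = 0 \<Longrightarrow> bil I M v v \<le> 0"
  shows "hyperbolic I M"
  unfolding hyperbolic_def
proof (intro allI impI)
  fix v w assume w: "bil I M w w > 0"
  have wh: "bil I M w h \<noteq> 0" using nsd[of w] w by force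
  define t where "t = bil I M v h / bil I M w h"
  have "bil I M (\<lambda>i. 1 * v i + (- t) * w i) h = 0"
    using wh by (simp only: bil_linear_left) (simp add: t_def)
  from nsd[OF this] have "bil I M v v - 2 * t * bil I M v w + t\<^sup>2 * bil I M w w \<le> 0"
    unfolding bil_quadratic[OF S] by simp
  then have "bil I M w w * (bil I M v v - 2 * t * bil I M v w + t\<^sup>2 * bil I M w w) \<le> 0"
    using w by (simp add: mult_le_0_iff)
  moreover have "(t * bil I M w w - bil I M v w)\<^sup>2 \<ge> 0" by simp
  ultimately show "bil I M v v * bil I M w w \<le> (bil I M v w)\<^sup>2"
    by (simp add: power2_eq_square algebra_simps)
qed

text \<open>The form is negative semidefinite on the complement of \<open>g\<close>, so the
  isotropic \<open>z\<close> maximizes it there and its first variation vanishes. Along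
  \<open>g\<close> itself the claim is the hypothesis \<open>zg\<close>.\<close>

lemma hyperbolic_kernel:
  assumes S: "symmetric_on I M" and H: "hyperbolic I M"
    and g: "bil I M g g > 0" and zg: "bil I M z g = 0" and zz: "bil I M z z = 0"
  shows "bil I M y z = 0"
proof -
  define a where "a = bil I M y g / bil I M g g"
  define y' where "y' = (\<lambda>i. 1 * y i + (- a) * g i)"
  have y'g: "bil I M y' g = 0"
    using g unfolding y'_def bil_linear_left by (simp add: a_def)
  have "0 \<le> 2 * t * (- bil I M z y') + t\<^sup>2 * (- bil I M y' y')" for t
  proof -
    let ?u = "\<lambda>i. 1 * z i + t * y' i"
    have "bil I M ?u g = 0" unfolding bil_linear_left by (simp add: zg y'g)
    moreover have "bil I M ?u ?u * bil I M g g \<le> (bil I M ?u g)\<^sup>2"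
      using H g unfolding hyperbolic_def by blast
    ultimately have "bil I M ?u ?u \<le> 0" using g by (simp add: mult_le_0_iff)
    then show ?thesis unfolding bil_quadratic[OF S] by (simp add: zz)
  qed
  then have "bil I M z y' = 0" using linear_coeff_zero by fastforce
  then have "bil I M y' z = 0" using bil_commute[OF S] by simp
  then show ?thesis
    using zg bil_commute[OF S, of g z] unfolding y'_def bil_linear_left by simp
qed

lemma hyperbolic_kernel_mv:
  assumes "symmetric_on I M" "hyperbolic I M"
    and "bil I M g g > 0" "bil I M z g = 0" "bil I M z z = 0" "finite I" "i \<in> I"
  shows "mv I M z i = 0"
proof -
  have "bil I M (\<lambda>j. if j = i then 1 else 0) z = 0"
    by (rule hyperbolic_kernel[OF assms(1-5)])
  then show ?thesis using assms(6,7) by (simp add: bil_def if_distrib if_distribR cong: if_cong)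
qed

text \<open>Nonnegativity is asked for along one line only, because the form in the application is
  controlled only on a hyperplane.\<close>

lemma psd_orthogonal:
  assumes S: "symmetric_on I M"
    and psd: "\<And>t. bil I M (\<lambda>i. 1 * x i + t * y i) (\<lambda>i. 1 * x i + t * y i) \<ge> 0"
    and xx: "bil I M x x = 0"
  shows "bil I M x y = 0"
proof (rule linear_coeff_zero)
  show "0 \<le> 2 * t * bil I M x y + t\<^sup>2 * bil I M y y" for t
    using psd[of t] unfolding bil_quadratic[OF S] by (simp add: xx)
qed

section \<open>Rayleigh quotients and the local-to-global principle\<close>

lemma compact_finite_box:
  fixes b :: "'i \<Rightarrow> real"
  shows "compact {x. (\<forall>i\<in>I. \<bar>x i\<bar> \<le> b i) \<and> (\<forall>i. i \<notin> I \<longrightarrow> x i = 0)}" (is "compact ?S")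
proof -
  \<comment> \<open>Forcing the value 0 off \<open>I\<close> makes the box a product of compact sets
    over all indices, so Tychonoff's theorem applies.\<close>
  have "?S = (\<Pi>\<^sub>E i\<in>UNIV. if i \<in> I then {- b i..b i} else {0})"
    by (auto simp: PiE_def Pi_def abs_le_iff minus_le_iff split: if_splits)
  moreover have "compactin (product_topology (\<lambda>i. euclidean) UNIV)
      (\<Pi>\<^sub>E i\<in>UNIV. if i \<in> I then {- b i..b i} else {0})"
    by (subst compactin_PiE) (auto split: if_splits)
  ultimately show ?thesis by (simp add: euclidean_product_topology)
qed

text \<open>Averaging the weighted square sum over both orders of each pair completes a square. For
  nonnegative \<open>M\<close> this bounds the Rayleigh quotient of the rescaled form by 1.\<close>

lemma perron_identity:
  assumes S: "symmetric_on I M" and h: "\<And>i. i \<in> I \<Longrightarrow> h i > 0"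
  shows "2 * ((\<Sum>i\<in>I. mv I M h i / h i * (x i)\<^sup>2) - bil I M x x) =
    (\<Sum>i\<in>I. \<Sum>j\<in>I. M i j * h i * h j * (x i / h i - x j / h j)\<^sup>2)"
proof -
  define f where "f = (\<lambda>i j. M i j * (h j / h i) * (x i)\<^sup>2)"
  have 1: "(\<Sum>i\<in>I. mv I M h i / h i * (x i)\<^sup>2) = (\<Sum>i\<in>I. \<Sum>j\<in>I. f i j)"
    by (simp add: f_def mv_def sum_distrib_left sum_distrib_right sum_divide_distrib)
  have "(\<Sum>i\<in>I. \<Sum>j\<in>I. f i j) = (\<Sum>i\<in>I. \<Sum>j\<in>I. f j i)"
    by (rule sum.swap)
  moreover have "bil I M x x = (\<Sum>i\<in>I. \<Sum>j\<in>I. M i j * x i * x j)"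
    by (simp add: bil_def mv_def sum_distrib_left mult_ac)
  ultimately have "2 * ((\<Sum>i\<in>I. mv I M h i / h i * (x i)\<^sup>2) - bil I M x x) =
      (\<Sum>i\<in>I. \<Sum>j\<in>I. f i j + f j i - 2 * (M i j * x i * x j))"
    unfolding 1 by (simp add: sum.distrib sum_subtractf sum_distrib_left[symmetric])
  also have "\<dots> = (\<Sum>i\<in>I. \<Sum>j\<in>I. M i j * h i * h j * (x i / h i - x j / h j)\<^sup>2)"
  proof (intro sum.cong refl)
    fix i j assume ij: "i \<in> I" "j \<in> I"
    have "M j i = M i j" using S ij by (auto simp: symmetric_on_def)
    then show "f i j + f j i - 2 * (M i j * x i * x j) =
        M i j * h i * h j * (x i / h i - x j / h j)\<^sup>2"
      using h[OF ij(1)] h[OF ij(2)] unfolding f_def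
      by (simp add: field_simps power2_eq_square)
  qed
  finally show ?thesis .
qed

text \<open>The matrix \<open>M\<close>, rescaled by the diagonal matrix with entries \<open>(M h)\<^sub>i / h\<^sub>i\<close>, has
  the simple top eigenvalue 1 with eigenvector \<open>h\<close>, by Perron-Frobenius. Hypothesis \<open>pull\<close>
  says that every eigenvalue satisfies \<open>\<lambda>\<^sup>2 \<ge> \<lambda>\<close>, so all others are nonpositive. Here
  the second largest eigenvalue is obtained by maximizing a Rayleigh quotient.\<close>

lemma hyperbolic_local_to_global:
  fixes M :: "'i \<Rightarrow> 'i \<Rightarrow> real"
  assumes fin: "finite I" and S: "symmetric_on I M"
    and nonneg: "\<And>i j. i \<in> I \<Longrightarrow> j \<in> I \<Longrightarrow> M i j \<ge> 0"
    and h: "\<And>i. i \<in> I \<Longrightarrow> h i > 0"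
    and e: "e \<in> I" "\<And>i. i \<in> I \<Longrightarrow> M i e > 0"
    and pull: "\<And>x. bil I M x x \<le> (\<Sum>i\<in>I. h i * (mv I M x i)\<^sup>2 / mv I M h i)"
  shows "hyperbolic I M"
proof (rule hyperbolic_of_neg_semidef[OF S, of h], rule ccontr)
  fix x0 assume x0h: "bil I M x0 h = 0" and "\<not> bil I M x0 x0 \<le> 0"
  then have x00: "bil I M x0 x0 > 0" by simp
  have Mh: "mv I M h i > 0" if "i \<in> I" for i
  proof -
    have "0 < M i e * h e" using h e that by simp
    also have "\<dots> \<le> mv I M h i" unfolding mv_def
      using fin e(1) nonneg[OF that] h by (intro member_le_sum) (auto simp: less_imp_le)
    finally show ?thesis .
  qed
  define d where "d = (\<lambda>i. mv I M h i / h i)"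
  have d: "d i > 0" if "i \<in> I" for i using Mh h that by (simp add: d_def)
  define D where "D = (\<lambda>x. \<Sum>i\<in>I. d i * (x i)\<^sup>2)"
  have Dnn: "D x \<ge> 0" for x unfolding D_def using d by (intro sum_nonneg) (simp add: less_imp_le)
  have D0: "x i = 0" if "D x = 0" "i \<in> I" for x i
  proof -
    have "d i * (x i)\<^sup>2 = 0"
      using that fin d unfolding D_def
      by (subst (asm) sum_nonneg_eq_0_iff) (auto simp: less_imp_le)
    then show ?thesis using d[OF that(2)] by simp
  qed
  have perron: "2 * (D x - bil I M x x) =
      (\<Sum>i\<in>I. \<Sum>j\<in>I. M i j * h i * h j * (x i / h i - x j / h j)\<^sup>2)" for x
    using perron_identity[OF S h] by (simp add: D_def d_def)
  have term_nn: "0 \<le> M i j * h i * h j * (x i / h i - x j / h j)\<^sup>2" if "i \<in> I" "j \<in> I" for i j x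
    using nonneg[OF that] h[OF that(1)] h[OF that(2)] by simp
  have top: "bil I M x x \<le> D x" for x
  proof -
    have "0 \<le> 2 * (D x - bil I M x x)"
      unfolding perron by (intro sum_nonneg term_nn)
    then show ?thesis by simp
  qed
  \<comment> \<open>The unit sphere of \<open>D\<close> in the complement of \<open>h\<close>. The
    coordinate bounds, which \<open>D x = 1\<close> implies, provide compactness.\<close>
  define K where "K = {x. (\<forall>i\<in>I. \<bar>x i\<bar> \<le> 1 / sqrt (d i)) \<and> (\<forall>i. i \<notin> I \<longrightarrow> x i = 0)}
      \<inter> {x. D x = 1} \<inter> {x. bil I M x h = 0}"
  have cont_i: "continuous_on UNIV (\<lambda>x. x i)" for i :: 'i
    by (rule continuous_on_product_coordinates)
  have contD: "continuous_on UNIV D"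
    unfolding D_def by (intro continuous_intros cont_i)
  have contB: "continuous_on UNIV (\<lambda>x. bil I M x h)"
    unfolding bil_def by (intro continuous_intros cont_i)
  have contQ: "continuous_on UNIV (\<lambda>x. bil I M x x)"
    unfolding bil_def mv_def by (intro continuous_intros cont_i)
  have "closed {x. D x = 1}" "closed {x. bil I M x h = 0}"
    using closed_Collect_eq[OF contD continuous_on_const]
      closed_Collect_eq[OF contB continuous_on_const] by auto
  then have "compact K"
    unfolding K_def by (intro compact_Int_closed compact_finite_box)
  have normalize: "\<exists>y\<in>K. bil I M y y = bil I M x x / D x"
    if "bil I M x h = 0" "D x > 0" for x
  proof
    define y where "y = (\<lambda>i. if i \<in> I then x i / sqrt (D x) else 0)"
    have y: "bil I M y u = bil I M (\<lambda>i. 1 / sqrt (D x) * x i + 0 * x i) u"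
      "bil I M u y = bil I M u (\<lambda>i. 1 / sqrt (D x) * x i + 0 * x i)" for u
      by (auto intro!: bil_cong simp: y_def)
    show "bil I M y y = bil I M x x / D x"
      unfolding y bil_linear_left bil_linear_right using that(2) by simp
    have Dy: "D y = 1"
    proof -
      have "D y = (\<Sum>i\<in>I. d i * (x i)\<^sup>2 / D x)"
        unfolding fun_cong[OF D_def, of y] using that(2)
        by (intro sum.cong refl) (simp add: y_def power_divide)
      then show ?thesis using that(2) by (simp add: sum_divide_distrib[symmetric] fun_cong[OF D_def, of x, symmetric])
    qed
    have "\<bar>y i\<bar> \<le> 1 / sqrt (d i)" if "i \<in> I" for i
    proof -
      have "d i * (y i)\<^sup>2 \<le> D y" unfolding D_def
        using fin that d by (intro member_le_sum) (auto simp: less_imp_le)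
      then have "(y i)\<^sup>2 \<le> 1 / d i" using Dy d[OF that] by (simp add: field_simps)
      then have "sqrt ((y i)\<^sup>2) \<le> sqrt (1 / d i)" by (rule real_sqrt_le_mono)
      then show ?thesis by (simp add: real_sqrt_divide)
    qed
    moreover have "bil I M y h = 0"
      unfolding y bil_linear_left using that by simp
    ultimately show "y \<in> K" using Dy by (auto simp: K_def y_def)
  qed
  have "D x0 > 0" using top[of x0] x00 by linarith
  then obtain y0 where y0: "y0 \<in> K" "bil I M y0 y0 > 0"
    using normalize[OF x0h] x00 by (metis divide_pos_pos)
  obtain x where x: "x \<in> K" and xmax: "\<And>y. y \<in> K \<Longrightarrow> bil I M y y \<le> bil I M x x"
    using continuous_attains_sup[OF \<open>compact K\<close> _ continuous_on_subset[OF contQ]] y0 by blast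
  define l where "l = bil I M x x"
  have l: "l > 0" using xmax[OF y0(1)] y0(2) by (simp add: l_def)
  have xh: "bil I M x h = 0" and Dx: "D x = 1" using x by (auto simp: K_def)
  have bound: "bil I M y y \<le> l * D y" if yh: "bil I M y h = 0" for y
  proof (cases "D y = 0")
    case True
    have "bil I M y y = 0" using D0[OF True] by (simp add: bil_def)
    then show ?thesis using True by simp
  next
    case False
    then have pos: "D y > 0" using Dnn[of y] by simp
    obtain y' where "y' \<in> K" "bil I M y' y' = bil I M y y / D y"
      using normalize[OF yh pos] by blast
    then have "bil I M y y / D y \<le> l" using xmax l_def by metis
    then show ?thesis using pos by (simp add: field_simps)
  qed
  \<comment> \<open>\<open>F\<close> is \<open>l\<close> times the rescaling diagonal minus
    \<open>M\<close>; by maximality of \<open>l\<close> its form is nonnegative on the complement of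
    \<open>h\<close>, with \<open>x\<close> isotropic.\<close>
  define F where "F = (\<lambda>i j. if i = j then l * d i - M i j else - M i j)"
  have mvF: "mv I F v i = l * d i * v i - mv I M v i" if "i \<in> I" for v i
  proof -
    have "mv I F v i = (\<Sum>j\<in>I. (if i = j then l * d i * v j else 0) - M i j * v j)"
      unfolding mv_def F_def by (intro sum.cong) (auto simp: algebra_simps)
    then show ?thesis using fin that by (simp add: sum_subtractf mv_def)
  qed
  have bilF: "bil I F v w = l * (\<Sum>i\<in>I. d i * v i * w i) - bil I M v w" for v w
    by (simp add: bil_def mvF algebra_simps sum_subtractf sum_distrib_left)
  have SF: "symmetric_on I F" using S by (auto simp: symmetric_on_def F_def)
  \<comment> \<open>The rescaled operator applied to \<open>x\<close>; testing \<open>F\<close>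
    against it replaces the eigenvector equation for \<open>x\<close>.\<close>
  define y where "y = (\<lambda>i. mv I M x i / d i)"
  have "bil I M y h = bil I M h x"
    unfolding bil_def
  proof (intro sum.cong refl)
    fix i assume "i \<in> I"
    then show "y i * mv I M h i = h i * mv I M x i"
      using h[of i] Mh[of i] by (simp add: y_def d_def)
  qed
  then have yh: "bil I M y h = 0" using bil_commute[OF S] xh by simp
  have "bil I F x y = 0"
  proof (rule psd_orthogonal[OF SF])
    show "bil I F x x = 0"
      using Dx by (simp add: bilF D_def l_def power2_eq_square mult.assoc)
    fix t
    have "bil I M (\<lambda>i. 1 * x i + t * y i) h = 0"
      unfolding bil_linear_left by (simp add: xh yh)
    from bound[OF this] show "0 \<le> bil I F (\<lambda>i. 1 * x i + t * y i) (\<lambda>i. 1 * x i + t * y i)"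
      by (simp add: bilF D_def power2_eq_square mult.assoc)
  qed
  then have "bil I M x y = l * (\<Sum>i\<in>I. d i * x i * y i)" by (simp add: bilF)
  also have "(\<Sum>i\<in>I. d i * x i * y i) = l"
    unfolding l_def bil_def using d
    by (intro sum.cong refl) (auto simp: y_def dest!: d)
  finally have "bil I M y x = l * l" using bil_commute[OF S] by simp
  moreover have "bil I M y x = (\<Sum>i\<in>I. h i * (mv I M x i)\<^sup>2 / mv I M h i)"
    unfolding bil_def by (intro sum.cong refl) (simp add: y_def d_def power2_eq_square)
  ultimately have "l \<le> l * l" using pull[of x] l_def by simp
  then have "l \<ge> 1" using l by simp
  then have "D x - bil I M x x = 0" using top[of x] Dx l_def by simp
  then have "(\<Sum>i\<in>I. \<Sum>j\<in>I. M i j * h i * h j * (x i / h i - x j / h j)\<^sup>2) = 0"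
    using perron[of x] by simp
  then have "M i j * h i * h j * (x i / h i - x j / h j)\<^sup>2 = 0" if "i \<in> I" "j \<in> I" for i j
    using that fin term_nn by (simp add: sum_nonneg_eq_0_iff sum_nonneg)
  \<comment> \<open>The positive column \<open>e\<close> links every index to \<open>e\<close>, so
    \<open>x\<close> is a multiple of \<open>h\<close>; but it is also orthogonal to
    \<open>h\<close>, and \<open>bil I M h h\<close> is positive.\<close>
  then have ratio: "x i / h i = x e / h e" if "i \<in> I" for i
    using e(2)[OF that] h[OF that] h[OF e(1)] e(1) that by fastforce
  have multiple: "x i = x e / h e * h i + 0 * h i" if "i \<in> I" for i
    using h[OF that] by (simp add: ratio[OF that, symmetric])
  have "bil I M x h = bil I M (\<lambda>i. x e / h e * h i + 0 * h i) h"
    by (intro bil_cong multiple refl)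
  then have "bil I M x h = x e / h e * bil I M h h"
    unfolding bil_linear_left by simp
  moreover have "bil I M h h > 0"
    unfolding bil_def using e(1) h Mh fin by (intro sum_pos) auto
  ultimately have "x e = 0" using xh h[OF e(1)] by simp
  then have "D x = 0" using multiple by (simp add: D_def)
  then show False using Dx by simp
qed

text \<open>The inequality is a closed condition, and the strict hypothesis
  \<open>bil I M w w > 0\<close> is open, so it persists for \<open>t\<close> near 1.\<close>

lemma hyperbolic_limit:
  assumes H: "\<And>t. 0 < t \<Longrightarrow> t < 1 \<Longrightarrow> hyperbolic I (\<lambda>i j. t * M i j + (1 - t) * M' i j)"
  shows "hyperbolic I M"
  unfolding hyperbolic_def
proof (intro allI impI)
  fix v w assume w: "bil I M w w > 0"
  define B where "B = (\<lambda>t v w. t * bil I M v w + (1 - t) * bil I M' v w)"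
  have lim: "((\<lambda>t. B t v w) \<longlongrightarrow> bil I M v w) (at_left 1)" for v w
  proof -
    have "((\<lambda>t. B t v w) \<longlongrightarrow> B 1 v w) (at_left 1)"
      unfolding B_def by (intro tendsto_intros)
    then show ?thesis by (simp add: B_def)
  qed
  have near: "\<forall>\<^sub>F t in at_left (1::real). 0 < t \<and> t < 1"
    using eventually_at_left_real[of 0 1] by (simp add: eventually_mono)
  show "bil I M v v * bil I M w w \<le> (bil I M v w)\<^sup>2"
  proof (rule tendsto_le)
    show "((\<lambda>t. (B t v w)\<^sup>2) \<longlongrightarrow> (bil I M v w)\<^sup>2) (at_left 1)"
      by (intro tendsto_intros lim)
    show "((\<lambda>t. B t v v * B t w w) \<longlongrightarrow> bil I M v v * bil I M w w) (at_left 1)"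
      by (intro tendsto_intros lim)
    show "\<forall>\<^sub>F t in at_left 1. B t v v * B t w w \<le> (B t v w)\<^sup>2"
      using order_tendstoD(1)[OF lim w] near
    proof eventually_elim
      case (elim t)
      then show ?case using H[of t] unfolding hyperbolic_def bil_matrix_linear B_def by blast
    qed
  qed simp
qed

section \<open>The atlas of an interval greedoid\<close>

locale admissible_greedoid = interval_greedoid X L for X :: "'a set" and L :: "'a list set" +
  fixes k :: nat and q :: "'a list \<Rightarrow> real" and c :: "nat \<Rightarrow> real"
  assumes k_less: "k < rk L" and adm: "admissible X L k q c"
begin

section \<open>Weights of continuations and exchange of adjacent letters\<close>

abbreviation W :: "'a list \<Rightarrow> nat \<Rightarrow> real" where "W \<equiv> cont_level_sum X L q"

lemma q_pos: "\<alpha> \<in> L \<Longrightarrow> q \<alpha> > 0" and q_zero: "\<alpha> \<notin> L \<Longrightarrow> q \<alpha> = 0"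
  using adm by (auto simp: admissible_def weight_function_def)

lemma q_nonneg: "q \<alpha> \<ge> 0"
  using q_pos[of \<alpha>] q_zero[of \<alpha>] by force

lemma c_pos: "i \<le> rk L \<Longrightarrow> c i > 0"
  using adm by (auto simp: admissible_def scale_sequence_def)

lemma subset_ground: "\<alpha> \<in> L \<Longrightarrow> set \<alpha> \<subseteq> X"
  using words by auto

lemma prefix1: "\<alpha> @ [x, y] \<in> L \<Longrightarrow> \<alpha> @ [x] \<in> L"
  using hereditary[of "\<alpha> @ [x]" "[y]"] by simp

lemma Cont_iff: "x \<in> Cont X L \<alpha> \<longleftrightarrow> \<alpha> @ [x] \<in> L"
  using hereditary subset_ground by (fastforce simp: Cont_def Cont_words_def)

lemma finite_Cont: "finite (Cont X L \<alpha>)"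
  by (rule finite_subset[OF _ finite_ground]) (use subset_ground in \<open>fastforce simp: Cont_iff\<close>)

lemma not_repeat: "\<alpha> @ [x, x] \<notin> L"
  using simple by fastforce

text \<open>As \<open>q\<close> vanishes off \<open>L\<close>, which is closed under prefixes, the
  sum may run over all words over \<open>X\<close>; the recursion in \<open>n\<close> then needs no
  membership conditions.\<close>

lemma W_eq: "W \<alpha> n = (\<Sum>\<beta> | set \<beta> \<subseteq> X \<and> length \<beta> = n. q (\<alpha> @ \<beta>))"
  unfolding cont_level_sum_def
proof (rule sum.mono_neutral_left)
  show "finite {\<beta>. set \<beta> \<subseteq> X \<and> length \<beta> = n}"
    using finite_lists_length_eq[OF finite_ground] .
  show "\<forall>\<beta>\<in>{\<beta>. set \<beta> \<subseteq> X \<and> length \<beta> = n} - Cont_words X L n \<alpha>. q (\<alpha> @ \<beta>) = 0"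
    using hereditary by (auto simp: Cont_words_def intro!: q_zero)
qed (auto simp: Cont_words_def)

lemma W_0: "W \<alpha> 0 = q \<alpha>"
proof -
  have "{\<beta>. set \<beta> \<subseteq> X \<and> length \<beta> = 0} = {[]}" by auto
  then show ?thesis unfolding W_eq by simp
qed

lemma W_Suc: "W \<alpha> (Suc n) = (\<Sum>x\<in>X. W (\<alpha> @ [x]) n)"
proof -
  let ?S = "{\<beta>. set \<beta> \<subseteq> X \<and> length \<beta> = n}"
  have "(\<Sum>x\<in>X. W (\<alpha> @ [x]) n) = (\<Sum>(x, \<beta>)\<in>X \<times> ?S. q (\<alpha> @ x # \<beta>))"
    by (simp add: W_eq sum.cartesian_product)
  also have "\<dots> = W \<alpha> (Suc n)"
    unfolding W_eq
    by (rule sum.reindex_bij_witness[of _ "\<lambda>\<gamma>. (hd \<gamma>, tl \<gamma>)" "\<lambda>(x, \<beta>). x # \<beta>"])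
      (auto simp: length_Suc_conv)
  finally show ?thesis by simp
qed

lemma W_nonneg: "W \<alpha> n \<ge> 0"
  unfolding W_eq by (intro sum_nonneg q_nonneg)

lemma W_outside: "\<alpha> \<notin> L \<Longrightarrow> W \<alpha> n = 0"
  using hereditary q_zero unfolding W_eq by (intro sum.neutral) blast

lemma W_outside_prefix: "\<alpha> @ [x] \<notin> L \<Longrightarrow> W (\<alpha> @ x # \<beta>) n = 0"
  using hereditary[of "\<alpha> @ [x]" \<beta>] by (auto intro!: W_outside)

lemma longest_word: "\<exists>\<mu>\<in>L. length \<mu> = rk L"
  using Max_in[of "length ` L"] finite_language empty_word unfolding rk_def by fastforce

text \<open>Exchange with a longest word extends \<open>\<alpha>\<close> by a letter as long as it
  is shorter than the rank.\<close>

lemma W_pos: "\<alpha> \<in> L \<Longrightarrow> length \<alpha> + n \<le> rk L \<Longrightarrow> W \<alpha> n > 0"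
proof (induction n arbitrary: \<alpha>)
  case 0
  then show ?case by (simp add: W_0 q_pos)
next
  case (Suc n)
  obtain \<mu> where "\<mu> \<in> L" "length \<mu> = rk L" using longest_word by blast
  then obtain x where x: "\<alpha> @ [x] \<in> L" using exchange[of \<mu> \<alpha>] Suc.prems by auto
  then have "x \<in> X" using subset_ground by fastforce
  have "0 < W (\<alpha> @ [x]) n" using x Suc by auto
  also have "\<dots> \<le> W \<alpha> (Suc n)" unfolding W_Suc
    using \<open>x \<in> X\<close> finite_ground by (intro member_le_sum W_nonneg)
  finally show ?case .
qed

lemma conditions:
  assumes "\<alpha> \<in> L" "length \<alpha> < k"
  shows "ContInv X L q \<alpha>" "PAMon X L q \<alpha>" "LogMod X L q c \<alpha>"
    "FewDes X L \<alpha>" "SynMon X L q c \<alpha>" "ScaleMon X L q c \<alpha>"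
  using adm assms by (auto simp: admissible_def)

lemma q_swap:
  assumes "length \<alpha> < k" "\<alpha> @ [x] \<in> L" "\<alpha> @ [y] \<in> L"
  shows "q (\<alpha> @ x # y # \<beta>) = q (\<alpha> @ y # x # \<beta>)"
proof (cases "set \<beta> \<subseteq> X")
  case True
  then show ?thesis
    using conditions(1)[OF hereditary[OF assms(2)] assms(1)] assms
    unfolding ContInv_def by (simp add: Cont_iff in_listsI subset_iff)
next
  case False
  then have "\<alpha> @ x # y # \<beta> \<notin> L" "\<alpha> @ y # x # \<beta> \<notin> L" using subset_ground by fastforce+
  then show ?thesis by (simp add: q_zero)
qed

lemma W_swap:
  assumes "length \<alpha> < k" "\<alpha> @ [x] \<in> L" "\<alpha> @ [y] \<in> L"
  shows "W (\<alpha> @ x # y # \<beta>) n = W (\<alpha> @ y # x # \<beta>) n"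
  unfolding W_eq using q_swap[OF assms, of "\<beta> @ _"]
  by (intro sum.cong refl) simp

text \<open>Membership in \<open>L\<close> is positivity of \<open>q\<close>, so it inherits the
  exchange symmetry.\<close>

lemma swap_in_L:
  assumes "length \<alpha> < k" "\<alpha> @ [x] \<in> L" "\<alpha> @ [y] \<in> L"
  shows "\<alpha> @ x # y # \<beta> \<in> L \<longleftrightarrow> \<alpha> @ y # x # \<beta> \<in> L"
  using q_swap[OF assms] q_pos[of "\<alpha> @ x # y # \<beta>"] q_pos[of "\<alpha> @ y # x # \<beta>"]
    q_zero[of "\<alpha> @ x # y # \<beta>"] q_zero[of "\<alpha> @ y # x # \<beta>"] by fastforce

text \<open>The interval property with single letters as middle words; this is how it enters the
  pullback inequality.\<close>

lemma skip_middle: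
  assumes "\<alpha> @ [z] \<in> L" "\<alpha> @ [x, y, z] \<in> L"
  shows "\<alpha> @ [x, z] \<in> L"
proof -
  have "set (\<alpha> @ [x, y, z]) \<subseteq> X" using subset_ground assms(2) by blast
  then show ?thesis using interval[of \<alpha> "[x]" "[y]" z] assms by auto
qed

text \<open>Letters are the indices \<open>Some x\<close>; the index \<open>None\<close> carries the words that end one level
  earlier. The diagonal collects the descendants, so that every row has the right sum.\<close>

definition idx :: "'a list \<Rightarrow> 'a option set" where
  "idx \<alpha> = insert None (Some ` Cont X L \<alpha>)"

fun atlas :: "'a list \<Rightarrow> nat \<Rightarrow> 'a option \<Rightarrow> 'a option \<Rightarrow> real" where
  "atlas \<alpha> n (Some x) (Some y) =
     (if x = y then \<Sum>z\<in>Des X L \<alpha> x. W (\<alpha> @ [x, z]) n else W (\<alpha> @ [x, y]) n)"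
| "atlas \<alpha> n (Some x) None = W (\<alpha> @ [x]) n"
| "atlas \<alpha> n None (Some x) = W (\<alpha> @ [x]) n"
| "atlas \<alpha> n None None = W \<alpha> n"

text \<open>Carries vectors on \<open>idx \<alpha>\<close> to vectors on
  \<open>idx (\<alpha> @ [x])\<close>. Letters that become available only after \<open>x\<close> are
  descendants of \<open>x\<close> and inherit its value.\<close>

definition shift :: "'a list \<Rightarrow> 'a \<Rightarrow> ('a option \<Rightarrow> real) \<Rightarrow> 'a option \<Rightarrow> real" where
  "shift \<alpha> x v i =
     (case i of None \<Rightarrow> v None | Some y \<Rightarrow> if \<alpha> @ [y] \<in> L then v (Some y) else v (Some x))"

text \<open>The plane spanned by the indicators of the letters and of the extra index. Every
  \<open>shift\<close> fixes it pointwise, so it is shared by all the matrices.\<close>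

definition two_valued :: "real \<Rightarrow> real \<Rightarrow> 'a option \<Rightarrow> real" where
  "two_valued s t i = (case i of None \<Rightarrow> t | Some _ \<Rightarrow> s)"

lemma two_valued_simps [simp]: "two_valued s t None = t" "two_valued s t (Some x) = s"
  by (simp_all add: two_valued_def)

lemma shift_None [simp]: "shift \<alpha> x v None = v None"
  by (simp add: shift_def)

lemma shift_two_valued [simp]: "shift \<alpha> x (two_valued s t) = two_valued s t"
  by (auto simp: shift_def two_valued_def split: option.split)

abbreviation act :: "'a list \<Rightarrow> nat \<Rightarrow> ('a option \<Rightarrow> real) \<Rightarrow> 'a option \<Rightarrow> real" where
  "act \<alpha> n \<equiv> mv (idx \<alpha>) (atlas \<alpha> n)"

abbreviation form :: "'a list \<Rightarrow> nat \<Rightarrow> ('a option \<Rightarrow> real) \<Rightarrow> ('a option \<Rightarrow> real) \<Rightarrow> real" where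
  "form \<alpha> n \<equiv> bil (idx \<alpha>) (atlas \<alpha> n)"

lemma finite_idx: "finite (idx \<alpha>)"
  by (simp add: idx_def finite_Cont)

lemma sum_idx: "(\<Sum>i\<in>idx \<alpha>. f i) = f None + (\<Sum>x\<in>Cont X L \<alpha>. f (Some x))"
  unfolding idx_def by (simp add: finite_Cont sum.reindex)

lemma Cont_subset: "Cont X L \<alpha> \<subseteq> X"
  using subset_ground by (fastforce simp: Cont_iff)

lemma sum_Cont:
  assumes "\<And>x. x \<in> X \<Longrightarrow> \<alpha> @ [x] \<notin> L \<Longrightarrow> f x = 0"
  shows "(\<Sum>x\<in>Cont X L \<alpha>. f x) = (\<Sum>x\<in>X. f x)"
  using assms finite_ground Cont_subset
  by (intro sum.mono_neutral_left) (auto simp: Cont_iff)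

lemma act_None: "act \<alpha> n v None = (\<Sum>x\<in>X. W (\<alpha> @ [x]) n * v (Some x)) + W \<alpha> n * v None"
  unfolding mv_def sum_idx by (simp add: sum_Cont W_outside)

text \<open>The descendants summed on the diagonal are the letters after
  \<open>\<alpha> @ [x]\<close> to which \<open>shift\<close> assigns \<open>v (Some x)\<close> for
  not continuing \<open>\<alpha>\<close>, so the row becomes an unrestricted sum over
  \<open>X\<close>.\<close>

lemma act_Some:
  assumes "\<alpha> @ [x] \<in> L"
  shows "act \<alpha> n v (Some x) =
    (\<Sum>y\<in>X. W (\<alpha> @ [x, y]) n * shift \<alpha> x v (Some y)) + W (\<alpha> @ [x]) n * v None"
proof -
  have fD: "finite (Des X L \<alpha> x)" using finite_ground by (simp add: Des_def)
  have x: "x \<in> Cont X L \<alpha>" using assms by (simp add: Cont_iff)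
  have "(\<Sum>y\<in>X. W (\<alpha> @ [x, y]) n * shift \<alpha> x v (Some y)) =
      (\<Sum>y\<in>Cont X L \<alpha> \<union> Des X L \<alpha> x. W (\<alpha> @ [x, y]) n * shift \<alpha> x v (Some y))"
    using finite_ground Cont_subset
    by (intro sum.mono_neutral_right) (auto simp: Cont_iff Des_def intro!: W_outside)
  also have "\<dots> = (\<Sum>y\<in>Cont X L \<alpha>. W (\<alpha> @ [x, y]) n * shift \<alpha> x v (Some y)) +
      (\<Sum>y\<in>Des X L \<alpha> x. W (\<alpha> @ [x, y]) n * shift \<alpha> x v (Some y))"
    using finite_Cont fD by (intro sum.union_disjoint) (auto simp: Cont_iff Des_def)
  also have "(\<Sum>y\<in>Des X L \<alpha> x. W (\<alpha> @ [x, y]) n * shift \<alpha> x v (Some y)) =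
      (\<Sum>y\<in>Cont X L \<alpha>. if x = y then (\<Sum>z\<in>Des X L \<alpha> x. W (\<alpha> @ [x, z]) n) * v (Some x) else 0)"
    using finite_Cont x by (simp add: shift_def Des_def sum_distrib_right)
  finally show ?thesis
    unfolding mv_def sum_idx
    by (simp add: sum.distrib[symmetric])
      (intro sum.cong refl, auto simp: shift_def Cont_iff W_outside not_repeat)
qed

lemma form_eq:
  "form \<alpha> n v w =
    (\<Sum>x\<in>X. v (Some x) * ((\<Sum>y\<in>X. W (\<alpha> @ [x, y]) n * shift \<alpha> x w (Some y)) + W (\<alpha> @ [x]) n * w None))
    + v None * ((\<Sum>x\<in>X. W (\<alpha> @ [x]) n * w (Some x)) + W \<alpha> n * w None)"
proof -
  have "(\<Sum>x\<in>Cont X L \<alpha>. v (Some x) * act \<alpha> n w (Some x)) =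
    (\<Sum>x\<in>Cont X L \<alpha>. v (Some x) * ((\<Sum>y\<in>X. W (\<alpha> @ [x, y]) n * shift \<alpha> x w (Some y)) + W (\<alpha> @ [x]) n * w None))"
    by (intro sum.cong refl) (simp add: act_Some Cont_iff)
  also have "\<dots> = (\<Sum>x\<in>X. v (Some x) * ((\<Sum>y\<in>X. W (\<alpha> @ [x, y]) n * shift \<alpha> x w (Some y)) + W (\<alpha> @ [x]) n * w None))"
    by (intro sum_Cont) (simp add: W_outside_prefix)
  finally show ?thesis
    unfolding bil_def sum_idx by (simp add: act_None)
qed

lemma form_two_valued:
  "form \<alpha> n v (two_valued s t) =
    (\<Sum>x\<in>X. v (Some x) * (s * W (\<alpha> @ [x]) (Suc n) + t * W (\<alpha> @ [x]) n))
    + v None * (s * W \<alpha> (Suc n) + t * W \<alpha> n)"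
  unfolding form_eq W_Suc shift_two_valued
  by (simp add: sum_distrib_left mult_ac)

lemma form_two_valued2:
  "form \<alpha> n (two_valued a b) (two_valued s t) =
    a * (s * W \<alpha> (Suc (Suc n)) + t * W \<alpha> (Suc n)) + b * (s * W \<alpha> (Suc n) + t * W \<alpha> n)"
  unfolding form_two_valued W_Suc[of \<alpha>]
  by (simp add: sum.distrib sum_distrib_left[symmetric])

lemma atlas_sym:
  assumes "length \<alpha> < k"
  shows "symmetric_on (idx \<alpha>) (atlas \<alpha> n)"
  unfolding symmetric_on_def
proof (intro ballI)
  fix i j assume "i \<in> idx \<alpha>" "j \<in> idx \<alpha>"
  then show "atlas \<alpha> n i j = atlas \<alpha> n j i"
    using W_swap[OF assms, of _ _ "[]"] by (cases i; cases j) (auto simp: idx_def Cont_iff)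
qed

text \<open>Pairing with \<open>two_valued t s\<close> leaves \<open>t\<close> times level
  \<open>n + 1\<close> plus \<open>s\<close> times level \<open>n\<close>, the entries of the
  mixture of the two matrices. With \<open>s = 1 - t\<close>, hyperbolicity at the longer word then
  bounds a row of the mixture.\<close>

lemma inheritance_Some:
  assumes "\<alpha> @ [x] \<in> L"
  shows "t * act \<alpha> (Suc n) v (Some x) + s * act \<alpha> n v (Some x) =
    form (\<alpha> @ [x]) n (shift \<alpha> x v) (two_valued t s)"
  unfolding act_Some[OF assms] form_two_valued
  by (simp add: algebra_simps sum.distrib sum_distrib_left)

lemma inheritance_None:
  "t * act \<alpha> (Suc n) v None + s * act \<alpha> n v None = form \<alpha> n v (two_valued t s)"
  unfolding act_None form_two_valued
  by (simp add: algebra_simps sum.distrib sum_distrib_left)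


section \<open>The pullback inequality\<close>

lemma sum3_rot:
  fixes F :: "'a \<Rightarrow> 'a \<Rightarrow> 'a \<Rightarrow> real"
  shows "(\<Sum>x\<in>X. \<Sum>y\<in>X. \<Sum>z\<in>X. F y z x) = (\<Sum>x\<in>X. \<Sum>y\<in>X. \<Sum>z\<in>X. F x y z)"
proof -
  have "(\<Sum>x\<in>X. \<Sum>y\<in>X. \<Sum>z\<in>X. F y z x) = (\<Sum>y\<in>X. \<Sum>x\<in>X. \<Sum>z\<in>X. F y z x)"
    by (rule sum.swap)
  also have "\<dots> = (\<Sum>y\<in>X. \<Sum>z\<in>X. \<Sum>x\<in>X. F y z x)"
    by (rule sum.cong[OF refl]) (rule sum.swap)
  finally show ?thesis .
qed

lemma sum3_swap:
  fixes F :: "'a \<Rightarrow> 'a \<Rightarrow> 'a \<Rightarrow> real"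
  shows "(\<Sum>x\<in>X. \<Sum>y\<in>X. \<Sum>z\<in>X. F x z y) = (\<Sum>x\<in>X. \<Sum>y\<in>X. \<Sum>z\<in>X. F x y z)"
  by (rule sum.cong[OF refl]) (rule sum.swap)

text \<open>The summands differ only where both letters continue \<open>\<alpha>\<close>, and there
  the difference is antisymmetric in \<open>x\<close> and \<open>y\<close>.\<close>

lemma shift_linear_sum:
  assumes "length \<alpha> < k"
  shows "(\<Sum>x\<in>X. \<Sum>y\<in>X. W (\<alpha> @ [x, y]) n * shift \<alpha> x v (Some y)) =
    (\<Sum>x\<in>X. \<Sum>y\<in>X. W (\<alpha> @ [x, y]) n * v (Some x))"
proof -
  define f where "f = (\<lambda>x y. (if \<alpha> @ [x] \<in> L \<and> \<alpha> @ [y] \<in> L then W (\<alpha> @ [x, y]) n else 0) * v (Some y))"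
  have "W (\<alpha> @ [x, y]) n * shift \<alpha> x v (Some y) = W (\<alpha> @ [x, y]) n * v (Some x) + (f x y - f y x)"
    for x y
    using W_swap[OF assms, of x y "[]" n]
    by (cases "\<alpha> @ [x] \<in> L") (auto simp: f_def shift_def W_outside_prefix)
  moreover have "(\<Sum>x\<in>X. \<Sum>y\<in>X. f x y) = (\<Sum>x\<in>X. \<Sum>y\<in>X. f y x)"
    by (rule sum.swap)
  ultimately show ?thesis by (simp add: sum.distrib sum_subtractf)
qed

text \<open>By \<open>shift_linear_sum\<close> the terms with the extra index agree on both sides.
  What remains is a sum over three-letter continuations, which \<open>PAMon\<close> makes
  nonnegative.\<close>

lemma pullback:
  assumes "length \<alpha> + 2 \<le> k" "\<alpha> \<in> L"
  shows "form \<alpha> (Suc n) v v \<le> (\<Sum>x\<in>X. form (\<alpha> @ [x]) n (shift \<alpha> x v) (shift \<alpha> x v))"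
proof -
  have len: "length \<alpha> < k" "\<And>x. length (\<alpha> @ [x]) < k" using assms(1) by auto
  define K where "K = (\<lambda>x y z. W (\<alpha> @ [x, y, z]) n)"
  define C where "C = (\<lambda>x. \<alpha> @ [x] \<in> L)"
  define D where "D = (\<lambda>x y. \<alpha> @ [x, y] \<in> L)"
  define a where "a = (\<lambda>x. v (Some x))"
  \<comment> \<open>\<open>u x y\<close> and \<open>tt x y z\<close> are the values at the last
    letter of \<open>v\<close> shifted once and twice; \<open>C\<close> and \<open>D\<close> record
    which words lie in \<open>L\<close>.\<close>
  define u where "u = (\<lambda>x y. if C y then a y else a x)"
  define tt where "tt = (\<lambda>x y z. if D x z then u x z else u x y)"
  have shift_u: "shift \<alpha> x v (Some y) = u x y" for x y
    by (simp add: shift_def u_def C_def a_def)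
  have shift_tt: "shift (\<alpha> @ [x]) y (shift \<alpha> x v) (Some z) = tt x y z" for x y z
    by (simp add: shift_def u_def C_def a_def tt_def D_def)
  have D_C: "C x" if "D x y" for x y using that prefix1 by (auto simp: C_def D_def)
  have K_D: "K x y z = 0" if "\<not> D x y" for x y z
    using that W_outside_prefix[of "\<alpha> @ [x]" y "[z]"] by (simp add: K_def D_def)
  have K_C: "K x y z = 0" if "\<not> C x" for x y z
    using that D_C K_D by blast
  have K_skip: "D x z" if "C z" "K x y z \<noteq> 0" for x y z
    using that W_outside skip_middle[of \<alpha> z x y] by (auto simp: C_def D_def K_def)
  have K_swap12: "K x y z = K y x z" if "C x" "C y" for x y z
    using that W_swap[OF len(1), of x y "[z]"] by (simp add: K_def C_def)
  have K_swap23: "K x y z = K x z y" if "D x y" "D x z" for x y z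
    using that W_swap[OF len(2), of x y z "[]"] by (simp add: K_def D_def)
  \<comment> \<open>On triples of letters that all continue \<open>\<alpha>\<close> the weight is
    invariant under all permutations; \<open>K_skip\<close> supplies the memberships needed to
    exchange the last two letters.\<close>
  define H where "H = (\<lambda>x y z. if C x \<and> C y \<and> C z then K x y z else 0)"
  have H12: "H x y z = H y x z" for x y z using K_swap12 by (simp add: H_def)
  have H23: "H x y z = H x z y" for x y z
  proof (cases "C x \<and> C y \<and> C z")
    case True
    then have "K x y z = K x z y" using K_swap23 K_skip K_D by metis
    then show ?thesis using True by (simp add: H_def)
  qed (auto simp: H_def)
  txt \<open>The summand of the difference, split by which letters of the word \<open>x y z\<close> continue
    \<open>\<alpha>\<close>. The sums of \<open>G1\<close> and \<open>G1'\<close> agree by rotation of the letters, and those of \<open>G3\<close>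
    and \<open>G5\<close> cancel by another rotation. Those of \<open>G2\<close> and \<open>G4\<close> run over the passive and the
    active letters, and after symmetrization in \<open>x\<close>, \<open>y\<close> they are governed by \<open>PAMon\<close>.\<close>
  define G where "G = (\<lambda>x y z. K x y z * (u x y * tt x y z - a x * u x y))"
  define G1 where "G1 = (\<lambda>x y z. H x y z * (a y * a z))"
  define G1' where "G1' = (\<lambda>x y z. H x y z * (a y * a x))"
  define G2 where "G2 = (\<lambda>x y z. if C x \<and> C y \<and> \<not> C z \<and> \<not> D x z \<and> \<not> D y z
      then K x y z * (a y * (a y - a x)) else 0)"
  define G3 where "G3 = (\<lambda>x y z. if C x \<and> C y \<and> \<not> C z \<and> \<not> D x z \<and> D y z
      then K x y z * (a y * (a y - a x)) else 0)"
  define G4 where "G4 = (\<lambda>x y z. if C x \<and> C z \<and> \<not> C y \<and> D z y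
      then K x y z * (a x * (a z - a x)) else 0)"
  define G5 where "G5 = (\<lambda>x y z. if C x \<and> C z \<and> \<not> C y \<and> \<not> D z y
      then K x y z * (a x * (a z - a x)) else 0)"
  have split: "G x y z = (G1 x y z - G1' x y z) + G2 x y z + G3 x y z + G4 x y z + G5 x y z" for x y z
  proof (cases "K x y z = 0")
    case True
    then show ?thesis
      by (simp add: G_def G1_def G1'_def G2_def G3_def G4_def G5_def H_def)
  next
    case False
    have "C x" using False K_C by blast
    then show ?thesis using K_skip[OF _ False]
      unfolding G_def G1_def G1'_def G2_def G3_def G4_def G5_def H_def tt_def u_def
      by (cases "C y"; cases "C z"; cases "D x z"; cases "D y z"; cases "D z y")
        (simp_all add: algebra_simps)
  qed
  let ?S = "\<lambda>F :: 'a \<Rightarrow> 'a \<Rightarrow> 'a \<Rightarrow> real. \<Sum>x\<in>X. \<Sum>y\<in>X. \<Sum>z\<in>X. F x y z"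
  have S1: "?S G1 = ?S G1'"
  proof -
    have "G1' y z x = G1 x y z" for x y z
      unfolding G1_def G1'_def using H12[of x y z] H23[of y x z] by simp
    then show ?thesis using sum3_rot[of G1'] by simp
  qed
  have S35: "?S G3 + ?S G5 = 0"
  proof -
    have "G3 x y z + G5 y z x = 0" for x y z
    proof -
      have "K x y z = K y z x" if "C x" "C y" "D y z"
        using that K_swap12 K_swap23 K_skip K_D by metis
      then show ?thesis using K_D[of y z x]
        by (auto simp: G3_def G5_def algebra_simps)
    qed
    then have "?S (\<lambda>x y z. G3 x y z + G5 y z x) = 0" by simp
    then show ?thesis by (simp add: sum.distrib sum3_rot[of G5])
  qed
  define P where "P = (\<lambda>x y. if C x \<and> C y then \<Sum>z\<in>Pas X L \<alpha> x y. K x y z else 0)"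
  define A where "A = (\<lambda>x y. if C x \<and> C y then \<Sum>z\<in>Act X L \<alpha> x y. K x y z else 0)"
  have K_in: "\<alpha> @ [x, y, z] \<in> L" if "K x y z \<noteq> 0" for x y z
    using that W_outside by (auto simp: K_def)
  have "(\<Sum>z\<in>X. G2 x y z) = P x y * (a y * (a y - a x))" for x y
  proof -
    have "(\<Sum>z\<in>X. G2 x y z) = (\<Sum>z\<in>Pas X L \<alpha> x y. G2 x y z)"
      using finite_ground K_in
      by (intro sum.mono_neutral_right) (auto simp: Pas_def G2_def C_def D_def)
    also have "\<dots> = P x y * (a y * (a y - a x))"
      by (auto simp: P_def sum_distrib_right G2_def Pas_def C_def D_def intro!: sum.cong)
    finally show ?thesis .
  qed
  then have S2: "?S G2 = (\<Sum>x\<in>X. \<Sum>y\<in>X. P x y * (a y * (a y - a x)))" by simp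
  \<comment> \<open>Exchanging the last two letters makes the one that does not continue
    \<open>\<alpha>\<close> the summation variable, which then ranges over the active set.\<close>
  have G4: "(\<Sum>z\<in>X. G4 x z y) = A x y * (a x * (a y - a x))" for x y
  proof -
    have K_eq: "K x z y = K x y z" if "C y" "D x z" for z
      using that K_swap23 K_skip K_D by metis
    have "(\<Sum>z\<in>X. G4 x z y) = (\<Sum>z\<in>Act X L \<alpha> x y. G4 x z y)"
    proof (intro sum.mono_neutral_right ballI)
      fix z assume z: "z \<in> X - Act X L \<alpha> x y"
      show "G4 x z y = 0"
      proof (rule ccontr)
        assume ne: "G4 x z y \<noteq> 0"
        then have "C x" "C y" "\<not> C z" "D y z" "K x z y \<noteq> 0" by (auto simp: G4_def split: if_splits)
        moreover have "D x z" using calculation(5) K_D by blast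
        moreover have "\<alpha> @ [x, y, z] \<in> L" using K_in K_eq calculation by auto
        ultimately show False using z by (auto simp: Act_def C_def D_def)
      qed
    qed (auto simp: finite_ground Act_def)
    also have "\<dots> = A x y * (a x * (a y - a x))"
    proof (cases "C x \<and> C y")
      case True
      then show ?thesis
        using K_eq by (auto simp: A_def sum_distrib_right G4_def Act_def C_def D_def intro!: sum.cong)
    qed (auto simp: A_def G4_def)
    finally show ?thesis .
  qed
  have S4: "?S G4 = (\<Sum>x\<in>X. \<Sum>y\<in>X. A x y * (a x * (a y - a x)))"
    using sum3_swap[of G4] by (simp add: G4)
  have Psym: "P x y = P y x" and Asym: "A x y = A y x" for x y
  proof -
    have iff: "\<alpha> @ [x, y, z] \<in> L \<longleftrightarrow> \<alpha> @ [y, x, z] \<in> L" if "C x" "C y" for z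
      using that swap_in_L[OF len(1), of x y "[z]"] by (simp add: C_def)
    have "Pas X L \<alpha> x y = Pas X L \<alpha> y x" if "C x" "C y"
      using iff[OF that] by (auto simp: Pas_def)
    then show "P x y = P y x" using K_swap12 by (auto simp: P_def intro!: sum.cong)
    have "Act X L \<alpha> x y = Act X L \<alpha> y x" if "C x" "C y"
      using iff[OF that] by (auto simp: Act_def)
    then show "A x y = A y x" using K_swap12 by (auto simp: A_def intro!: sum.cong)
  qed
  have PA: "A x y \<le> P x y" if "x \<noteq> y" for x y
    using conditions(2)[OF assms(2) len(1)] that
    by (auto simp: PAMon_def A_def P_def K_def cont_level_sum_def Cont_iff C_def)
  have S24: "0 \<le> ?S G2 + ?S G4"
  proof -
    define f where "f = (\<lambda>x y. P x y * (a y * (a y - a x)) + A x y * (a x * (a y - a x)))"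
    have f2: "?S G2 + ?S G4 = (\<Sum>x\<in>X. \<Sum>y\<in>X. f x y)"
      by (simp add: S2 S4 f_def sum.distrib)
    also have "\<dots> = (\<Sum>x\<in>X. \<Sum>y\<in>X. f y x)" by (rule sum.swap)
    finally have "2 * (?S G2 + ?S G4) = (\<Sum>x\<in>X. \<Sum>y\<in>X. f x y + f y x)"
      using f2 by (simp add: sum.distrib)
    also have "\<dots> = (\<Sum>x\<in>X. \<Sum>y\<in>X. (P x y - A x y) * (a y - a x)\<^sup>2)"
      by (intro sum.cong refl)
        (simp add: f_def Psym[of y x for x y] Asym[of y x for x y] algebra_simps power2_eq_square)
    also have "\<dots> \<ge> 0"
    proof (intro sum_nonneg)
      fix x y show "0 \<le> (P x y - A x y) * (a y - a x)\<^sup>2"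
        using PA[of x y] by (cases "x = y") auto
    qed
    finally show ?thesis by simp
  qed
  have "0 \<le> ?S G"
    using S1 S24 S35 by (simp add: split sum.distrib sum_subtractf)
  moreover have "(\<Sum>x\<in>X. form (\<alpha> @ [x]) n (shift \<alpha> x v) (shift \<alpha> x v)) - form \<alpha> (Suc n) v v = ?S G"
  proof -
    define w where "w = (\<lambda>x y. W (\<alpha> @ [x, y]) n)"
    have lin: "(\<Sum>x\<in>X. \<Sum>y\<in>X. w x y * u x y) = (\<Sum>x\<in>X. \<Sum>y\<in>X. w x y * a x)"
      using shift_linear_sum[OF len(1), of n v] by (simp add: shift_u w_def a_def)
    have "(\<Sum>x\<in>X. form (\<alpha> @ [x]) n (shift \<alpha> x v) (shift \<alpha> x v)) =
        ?S (\<lambda>x y z. K x y z * (u x y * tt x y z)) + 2 * v None * (\<Sum>x\<in>X. \<Sum>y\<in>X. w x y * u x y)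
        + v None * v None * (\<Sum>x\<in>X. W (\<alpha> @ [x]) n)"
      unfolding form_eq append_assoc append_Cons append_Nil
      by (simp add: shift_u K_def w_def algebra_simps sum.distrib sum_distrib_left
          shift_tt[simplified])
    moreover have "form \<alpha> (Suc n) v v =
        ?S (\<lambda>x y z. K x y z * (a x * u x y)) + 2 * v None * (\<Sum>x\<in>X. \<Sum>y\<in>X. w x y * a x)
        + v None * v None * (\<Sum>x\<in>X. W (\<alpha> @ [x]) n)"
      unfolding form_eq shift_u W_Suc append_assoc append_Cons append_Nil
      by (simp add: K_def w_def a_def algebra_simps sum.distrib sum_distrib_left)
    ultimately show ?thesis
      unfolding lin G_def by (simp add: right_diff_distrib sum_subtractf)
  qed
  ultimately show ?thesis by simp
qed

section \<open>Hyperbolicity\<close>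

definition parcl :: "'a list \<Rightarrow> 'a \<Rightarrow> 'a set" where
  "parcl \<alpha> x = par_rel X L \<alpha> `` {x}"

text \<open>By \<open>LogMod\<close>, the scaled weight of two non-parallel continuations taken one
  after the other factors into their ratios, relative to that of \<open>\<alpha>\<close>.\<close>

definition ratio :: "'a list \<Rightarrow> 'a \<Rightarrow> real" where
  "ratio \<alpha> x = scaled q c (\<alpha> @ [x]) / scaled q c \<alpha>"

text \<open>The level 0 form depends on the letters only through these sums, one per class and one
  over all continuations.\<close>

definition class_sum :: "'a list \<Rightarrow> ('a option \<Rightarrow> real) \<Rightarrow> 'a set \<Rightarrow> real" where
  "class_sum \<alpha> v P = (\<Sum>x\<in>P. ratio \<alpha> x * v (Some x))"

abbreviation b :: "'a list \<Rightarrow> 'a set \<Rightarrow> real" where "b \<equiv> par_coeff X L q c"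

lemma parcl_iff: "y \<in> parcl \<alpha> x \<longleftrightarrow> \<alpha> @ [x] \<in> L \<and> \<alpha> @ [y] \<in> L \<and> \<alpha> @ [x, y] \<notin> L"
  by (auto simp: parcl_def par_rel_def Cont_iff)

lemma length_le_rk: "\<alpha> \<in> L \<Longrightarrow> length \<alpha> \<le> rk L"
  unfolding rk_def using finite_language by (intro Max_ge) auto

lemma scaled_pos: "\<alpha> \<in> L \<Longrightarrow> scaled q c \<alpha> > 0"
  using q_pos c_pos length_le_rk by (simp add: scaled_def)

lemma q_scaled: "\<alpha> \<in> L \<Longrightarrow> q \<alpha> = c (length \<alpha>) * scaled q c \<alpha>"
  using c_pos[OF length_le_rk] by (fastforce simp: scaled_def)

lemma ratio_pos: "\<alpha> @ [x] \<in> L \<Longrightarrow> ratio \<alpha> x > 0"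
  using scaled_pos hereditary unfolding ratio_def by (metis divide_pos_pos)

lemma q_ratio: "\<alpha> @ [x] \<in> L \<Longrightarrow> q (\<alpha> @ [x]) = c (Suc (length \<alpha>)) * scaled q c \<alpha> * ratio \<alpha> x"
  using q_scaled[of "\<alpha> @ [x]"] scaled_pos[OF hereditary, of \<alpha> "[x]"] by (simp add: ratio_def)

lemma sum_Par:
  fixes f :: "'a \<Rightarrow> real"
  shows "(\<Sum>x\<in>Cont X L \<alpha>. f x * g (parcl \<alpha> x)) = (\<Sum>P\<in>Par X L \<alpha>. (\<Sum>x\<in>P. f x) * g P)"
proof -
  have eq: "equiv (Cont X L \<alpha>) (par_rel X L \<alpha>)" by (rule equiv_par_rel)
  have cls: "parcl \<alpha> x = P" if "P \<in> Par X L \<alpha>" "x \<in> P" for x P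
    using that eq unfolding Par_def parcl_def
    by (metis Image_singleton_iff equiv_class_eq_iff quotientE)
  have "(\<Sum>x\<in>Cont X L \<alpha>. f x * g (parcl \<alpha> x)) = (\<Sum>x\<in>\<Union> (Par X L \<alpha>). f x * g (parcl \<alpha> x))"
    using Union_quotient[OF eq] by (simp add: Par_def)
  also have "\<dots> = (\<Sum>P\<in>Par X L \<alpha>. \<Sum>x\<in>P. f x * g (parcl \<alpha> x))"
    using quotient_disj[OF eq] finite_subset[OF in_quotient_imp_subset[OF eq] finite_Cont]
    by (subst sum.Union_disjoint) (auto simp: Par_def)
  also have "\<dots> = (\<Sum>P\<in>Par X L \<alpha>. (\<Sum>x\<in>P. f x) * g P)"
    by (intro sum.cong refl) (simp add: cls sum_distrib_right)
  finally show ?thesis .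
qed

lemma Par_eq: "Par X L \<alpha> = parcl \<alpha> ` Cont X L \<alpha>"
  by (auto simp: Par_def parcl_def quotient_def)

text \<open>By \<open>FewDes\<close> a class with several letters has no descendants, in agreement
  with the value 0 of \<open>b\<close> there. Hence \<open>b\<close> accounts for the diagonal entry
  in both cases.\<close>

lemma b_parcl:
  assumes x: "\<alpha> @ [x] \<in> L" and len: "length \<alpha> < k"
  obtains "parcl \<alpha> x = {x}"
      "b \<alpha> {x} = (\<Sum>y\<in>Des X L \<alpha> x. scaled q c \<alpha> * scaled q c (\<alpha> @ [x, y])) / (scaled q c (\<alpha> @ [x]))\<^sup>2"
    | "b \<alpha> (parcl \<alpha> x) = 0" "Des X L \<alpha> x = {}"
proof (cases "parcl \<alpha> x = {x}")
  case True
  then show ?thesis by (intro that(1)) (simp_all add: par_coeff_def sum_divide_distrib)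
next
  case False
  have xin: "x \<in> parcl \<alpha> x" using x not_repeat by (simp add: parcl_iff)
  have "finite (parcl \<alpha> x)"
    by (rule finite_subset[OF _ finite_Cont[of \<alpha>]]) (auto simp: parcl_iff Cont_iff)
  moreover obtain y where "y \<in> parcl \<alpha> x" "y \<noteq> x" using xin False by auto
  ultimately have "card {x, y} \<le> card (parcl \<alpha> x)"
    using xin by (intro card_mono) auto
  then have "card (parcl \<alpha> x) \<ge> 2" using \<open>y \<noteq> x\<close> by simp
  moreover have "parcl \<alpha> x \<in> Par X L \<alpha>" using x by (auto simp: Par_eq Cont_iff)
  ultimately have "Des X L \<alpha> x = {}"
    using conditions(4)[OF hereditary[OF x] len] xin by (auto simp: FewDes_def)
  moreover have "\<not> is_singleton (parcl \<alpha> x)"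
    using xin \<open>y \<in> parcl \<alpha> x\<close> \<open>y \<noteq> x\<close> by (auto simp: is_singleton_def)
  ultimately show ?thesis by (intro that(2)) (simp_all add: par_coeff_def)
qed

lemma b_le_1:
  assumes "P \<in> Par X L \<alpha>" "length \<alpha> < k"
  shows "b \<alpha> P \<le> 1"
proof -
  obtain x where x: "\<alpha> @ [x] \<in> L" "P = parcl \<alpha> x" using assms(1) by (auto simp: Par_eq Cont_iff)
  show ?thesis
    using x(1) assms(2)
  proof (cases rule: b_parcl)
    case 1
    have "(\<Sum>y\<in>Des X L \<alpha> x. scaled q c \<alpha> * scaled q c (\<alpha> @ [x, y])) \<le> (scaled q c (\<alpha> @ [x]))\<^sup>2"
      using conditions(5)[OF hereditary[OF x(1)] assms(2)] x(1) by (simp add: SynMon_def Cont_iff)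
    then show ?thesis using 1 scaled_pos[OF x(1)] x(2) by (simp add: divide_le_eq_1)
  next
    case 2
    then show ?thesis using x(2) by simp
  qed
qed

lemma act_base_None:
  assumes "\<alpha> \<in> L"
  shows "act \<alpha> 0 v None = scaled q c \<alpha> *
    (c (Suc (length \<alpha>)) * class_sum \<alpha> v (Cont X L \<alpha>) + c (length \<alpha>) * v None)"
proof -
  have "(\<Sum>x\<in>Cont X L \<alpha>. q (\<alpha> @ [x]) * v (Some x)) =
      (\<Sum>x\<in>Cont X L \<alpha>. scaled q c \<alpha> * c (Suc (length \<alpha>)) * (ratio \<alpha> x * v (Some x)))"
    by (intro sum.cong refl) (simp add: Cont_iff q_ratio)
  then show ?thesis
    unfolding mv_def sum_idx class_sum_def
    by (simp add: W_0 q_scaled[OF assms] algebra_simps sum_distrib_left)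
qed

text \<open>Entries between different classes come from a rank-one matrix by \<open>LogMod\<close>,
  those between distinct letters of a class vanish, and the diagonal is governed by
  \<open>b\<close>. So the row is a rank-one part minus a correction from the class of
  \<open>x\<close>.\<close>

lemma act_base_Some:
  assumes x: "\<alpha> @ [x] \<in> L" and len: "length \<alpha> < k"
  defines "P \<equiv> parcl \<alpha> x"
  shows "act \<alpha> 0 v (Some x) = scaled q c \<alpha> * ratio \<alpha> x *
    (c (length \<alpha> + 2) * (class_sum \<alpha> v (Cont X L \<alpha>) - (1 - b \<alpha> P) * class_sum \<alpha> v P)
     + c (Suc (length \<alpha>)) * v None)"
proof -
  let ?A = "c (length \<alpha> + 2) * (scaled q c \<alpha> * ratio \<alpha> x)"
  let ?f = "\<lambda>y. ratio \<alpha> y * v (Some y)"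
  have w: "scaled q c \<alpha> > 0" using scaled_pos hereditary[OF x] by blast
  have xP: "x \<in> P" using x not_repeat by (simp add: P_def parcl_iff)
  have xC: "x \<in> Cont X L \<alpha>" using x by (simp add: Cont_iff)
  have PC: "P \<subseteq> Cont X L \<alpha>" by (auto simp: P_def parcl_iff Cont_iff)
  have off: "q (\<alpha> @ [x, y]) = ?A * ratio \<alpha> y" if "\<alpha> @ [x, y] \<in> L" "\<alpha> @ [y] \<in> L" for y
  proof -
    have "scaled q c (\<alpha> @ [x]) * scaled q c (\<alpha> @ [y]) = scaled q c \<alpha> * scaled q c (\<alpha> @ [x, y])"
      using conditions(3)[OF hereditary[OF x] len] that x by (simp add: LogMod_def Cont_iff)
    then have "scaled q c (\<alpha> @ [x, y]) = scaled q c \<alpha> * ratio \<alpha> x * ratio \<alpha> y"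
      using w by (simp add: ratio_def field_simps)
    then show ?thesis using q_scaled[OF that(1)] by simp
  qed
  have diag: "(\<Sum>z\<in>Des X L \<alpha> x. q (\<alpha> @ [x, z])) = ?A * (b \<alpha> P * ratio \<alpha> x)"
    using x len
  proof (cases rule: b_parcl)
    case 1
    have "(\<Sum>z\<in>Des X L \<alpha> x. q (\<alpha> @ [x, z])) =
        c (length \<alpha> + 2) * (\<Sum>z\<in>Des X L \<alpha> x. scaled q c (\<alpha> @ [x, z]))"
      unfolding sum_distrib_left
    proof (intro sum.cong refl)
      fix z assume "z \<in> Des X L \<alpha> x"
      then show "q (\<alpha> @ [x, z]) = c (length \<alpha> + 2) * scaled q c (\<alpha> @ [x, z])"
        using q_scaled[of "\<alpha> @ [x, z]"] by (simp add: Des_def)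
    qed
    then show ?thesis
      unfolding P_def 1 ratio_def using w scaled_pos[OF x]
      by (simp add: sum_distrib_left[symmetric] power2_eq_square)
  qed (simp add: P_def)
  have row: "atlas \<alpha> 0 (Some x) (Some y) * v (Some y) =
      ?A * (?f y - (if y \<in> P then ?f y else 0) + (if y = x then b \<alpha> P * ?f x else 0))"
    if "y \<in> Cont X L \<alpha>" for y
  proof (cases "y = x")
    case True
    then show ?thesis using diag xP by (simp add: W_0)
  next
    case False
    then show ?thesis
      using off[of y] that x by (auto simp: W_0 P_def parcl_iff Cont_iff q_zero)
  qed
  \<comment> \<open>\<open>b\<close> is nonzero only on singleton classes, where the class sum has
    one term.\<close>
  have "b \<alpha> P * ?f x = b \<alpha> P * class_sum \<alpha> v P"
    using x len by (cases rule: b_parcl) (simp_all add: P_def class_sum_def)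
  moreover have "(\<Sum>y\<in>Cont X L \<alpha>. if y \<in> P then ?f y else 0) = class_sum \<alpha> v P"
    unfolding class_sum_def using PC finite_Cont
    by (simp add: sum.inter_restrict[symmetric] Int_absorb1)
  ultimately have "(\<Sum>y\<in>Cont X L \<alpha>. atlas \<alpha> 0 (Some x) (Some y) * v (Some y)) =
      ?A * (class_sum \<alpha> v (Cont X L \<alpha>) - class_sum \<alpha> v P + b \<alpha> P * class_sum \<alpha> v P)"
    using xC finite_Cont
    by (simp add: row sum_distrib_left[symmetric] sum.distrib sum_subtractf class_sum_def
        del: atlas.simps)
  then show ?thesis
    unfolding mv_def sum_idx using q_ratio[OF x]
    by (simp add: W_0 algebra_simps del: atlas.simps(1))
qed

lemma form_base:
  assumes "\<alpha> \<in> L" "length \<alpha> < k"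
  shows "form \<alpha> 0 v v = scaled q c \<alpha> *
    (c (length \<alpha> + 2) * ((class_sum \<alpha> v (Cont X L \<alpha>))\<^sup>2
        - (\<Sum>P\<in>Par X L \<alpha>. (1 - b \<alpha> P) * (class_sum \<alpha> v P)\<^sup>2))
     + 2 * c (Suc (length \<alpha>)) * class_sum \<alpha> v (Cont X L \<alpha>) * v None
     + c (length \<alpha>) * (v None)\<^sup>2)"
proof -
  let ?S = "class_sum \<alpha> v (Cont X L \<alpha>)"
  let ?f = "\<lambda>x. ratio \<alpha> x * v (Some x)"
  let ?g = "\<lambda>P. (1 - b \<alpha> P) * class_sum \<alpha> v P"
  have "(\<Sum>x\<in>Cont X L \<alpha>. v (Some x) * act \<alpha> 0 v (Some x)) =
    (\<Sum>x\<in>Cont X L \<alpha>. scaled q c \<alpha> * (c (length \<alpha> + 2) * (?f x * ?S - ?f x * ?g (parcl \<alpha> x))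
      + ?f x * (c (Suc (length \<alpha>)) * v None)))"
    using assms by (intro sum.cong refl) (simp add: act_base_Some Cont_iff algebra_simps)
  also have "\<dots> = scaled q c \<alpha> *
      (c (length \<alpha> + 2) * ((\<Sum>x\<in>Cont X L \<alpha>. ?f x) * ?S - (\<Sum>x\<in>Cont X L \<alpha>. ?f x * ?g (parcl \<alpha> x)))
        + (\<Sum>x\<in>Cont X L \<alpha>. ?f x) * (c (Suc (length \<alpha>)) * v None))"
    by (simp only: sum_distrib_left[symmetric] sum_distrib_right[symmetric] sum.distrib sum_subtractf)
  also have "(\<Sum>x\<in>Cont X L \<alpha>. ?f x * ?g (parcl \<alpha> x)) = (\<Sum>P\<in>Par X L \<alpha>. class_sum \<alpha> v P * ?g P)"
    using sum_Par[of ?f ?g \<alpha>] by (simp add: class_sum_def)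
  also have "(\<Sum>x\<in>Cont X L \<alpha>. ?f x) = ?S" by (simp add: class_sum_def)
  finally show ?thesis
    unfolding bil_def sum_idx act_base_None[OF assms(1)]
    by (simp add: power2_eq_square algebra_simps)
qed

text \<open>Orthogonality to the indicator of the extra index determines \<open>v None\<close>;
  eliminating it leaves a positive multiple of \<open>d * ?S\<^sup>2 - ?T\<close>. If
  \<open>d\<close> is not positive, \<open>SynMon\<close> gives the sign; otherwise Cauchy-Schwarz
  with weights \<open>sqrt (1 - b \<alpha> P)\<close> reduces it to \<open>ScaleMon\<close>.\<close>

lemma hyperbolic_base:
  assumes "\<alpha> \<in> L" "length \<alpha> < k"
  shows "hyperbolic (idx \<alpha>) (atlas \<alpha> 0)"
proof (rule hyperbolic_of_neg_semidef[OF atlas_sym[OF assms(2)], of _ "two_valued 0 1"])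
  fix v assume "form \<alpha> 0 v (two_valued 0 1) = 0"
  let ?c0 = "c (length \<alpha>)" and ?c1 = "c (Suc (length \<alpha>))" and ?c2 = "c (length \<alpha> + 2)"
  let ?S = "class_sum \<alpha> v (Cont X L \<alpha>)" and ?Y = "class_sum \<alpha> v"
  let ?T = "\<Sum>P\<in>Par X L \<alpha>. (1 - b \<alpha> P) * (?Y P)\<^sup>2"
  define d where "d = 1 - ?c1\<^sup>2 / (?c0 * ?c2)"
  have c: "?c0 > 0" "?c1 > 0" "?c2 > 0" using c_pos assms(2) k_less by auto
  have w: "scaled q c \<alpha> > 0" using assms(1) by (rule scaled_pos)
  have S_eq: "?S = (\<Sum>P\<in>Par X L \<alpha>. ?Y P)"
    using sum_Par[of "\<lambda>x. ratio \<alpha> x * v (Some x)" "\<lambda>_. 1" \<alpha>] by (simp add: class_sum_def)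
  have "act \<alpha> 0 v None = 0"
    using \<open>form \<alpha> 0 v (two_valued 0 1) = 0\<close> unfolding act_None form_two_valued by (simp add: mult_ac)
  then have "?c1 * ?S + ?c0 * v None = 0" using w by (simp add: act_base_None[OF assms(1)])
  then have vN: "v None = - ?c1 * ?S / ?c0" using c by (simp add: field_simps)
  have "d * ?S\<^sup>2 \<le> ?T"
  proof (cases "d \<le> 0")
    case True
    have "0 \<le> ?T" using b_le_1[OF _ assms(2)] by (intro sum_nonneg) simp
    moreover have "d * ?S\<^sup>2 \<le> 0" using True by (simp add: mult_le_0_iff)
    ultimately show ?thesis by linarith
  next
    case False
    then have "?c1\<^sup>2 < ?c0 * ?c2" using c by (simp add: d_def field_simps)
    then have b1: "\<And>P. P \<in> Par X L \<alpha> \<Longrightarrow> b \<alpha> P < 1"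
      and sc: "d * (\<Sum>P\<in>Par X L \<alpha>. 1 / (1 - b \<alpha> P)) \<le> 1"
      using conditions(6)[OF assms] by (simp_all add: ScaleMon_def Let_def d_def)
    have "?S\<^sup>2 = (\<Sum>P\<in>Par X L \<alpha>. 1 / sqrt (1 - b \<alpha> P) * (sqrt (1 - b \<alpha> P) * ?Y P))\<^sup>2"
      unfolding S_eq using b1 by (intro arg_cong[where f = "\<lambda>x. x\<^sup>2"] sum.cong refl) force
    also have "\<dots> \<le> (\<Sum>P\<in>Par X L \<alpha>. (1 / sqrt (1 - b \<alpha> P))\<^sup>2) *
        (\<Sum>P\<in>Par X L \<alpha>. (sqrt (1 - b \<alpha> P) * ?Y P)\<^sup>2)"
      by (rule Cauchy_Schwarz_ineq_sum)
    also have "(\<Sum>P\<in>Par X L \<alpha>. (1 / sqrt (1 - b \<alpha> P))\<^sup>2) = (\<Sum>P\<in>Par X L \<alpha>. 1 / (1 - b \<alpha> P))"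
      using b1 by (intro sum.cong refl) (simp add: power_divide less_imp_le)
    also have "(\<Sum>P\<in>Par X L \<alpha>. (sqrt (1 - b \<alpha> P) * ?Y P)\<^sup>2) = ?T"
      using b1 by (intro sum.cong refl) (simp add: power_mult_distrib less_imp_le)
    finally have "d * ?S\<^sup>2 \<le> d * ((\<Sum>P\<in>Par X L \<alpha>. 1 / (1 - b \<alpha> P)) * ?T)"
      using False by (intro mult_left_mono) auto
    also have "\<dots> = (d * (\<Sum>P\<in>Par X L \<alpha>. 1 / (1 - b \<alpha> P))) * ?T" by simp
    also have "\<dots> \<le> 1 * ?T"
      using sc b_le_1[OF _ assms(2)] by (intro mult_right_mono sum_nonneg) auto
    finally show ?thesis by simp
  qed
  moreover have "form \<alpha> 0 v v = scaled q c \<alpha> * ?c2 * (d * ?S\<^sup>2 - ?T)"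
    unfolding form_base[OF assms] vN d_def using c
    by (simp add: field_simps power2_eq_square)
  ultimately show "form \<alpha> 0 v v \<le> 0" using w c by (simp add: mult_le_0_iff)
qed

section \<open>Propagation of hyperbolicity to higher levels\<close>

lemma atlas_nonneg: "atlas \<alpha> n i j \<ge> 0"
  by (cases i; cases j) (auto intro!: sum_nonneg W_nonneg)

lemma hyperbolic_atlas:
  "\<alpha> \<in> L \<Longrightarrow> length \<alpha> + n < k \<Longrightarrow> hyperbolic (idx \<alpha>) (atlas \<alpha> n)"
proof (induction n arbitrary: \<alpha>)
  case 0
  then show ?case by (simp add: hyperbolic_base)
next
  case (Suc n)
  have len: "length \<alpha> < k" using Suc.prems by simp
  show ?case
  \<comment> \<open>At \<open>t = 1\<close> the vector \<open>?h\<close> would vanish at the extra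
    index. For \<open>t < 1\<close> it is positive, and the matrix itself is recovered in the
    limit.\<close>
  proof (rule hyperbolic_limit[of _ _ "atlas \<alpha> n"])
    fix t :: real assume t: "0 < t" "t < 1"
    let ?M = "\<lambda>i j. t * atlas \<alpha> (Suc n) i j + (1 - t) * atlas \<alpha> n i j"
    let ?h = "two_valued t (1 - t)"
    have Wpos: "W \<beta> n > 0" "W \<beta> (Suc n) \<ge> 0" if "\<beta> \<in> L" "length \<beta> \<le> length \<alpha> + 1" for \<beta>
      using that Suc.prems k_less by (auto intro!: W_pos W_nonneg)
    have form_pos: "form \<beta> n ?h ?h > 0" if "\<beta> \<in> L" "length \<beta> \<le> length \<alpha> + 1" for \<beta>
    proof -
      have "0 < (1 - t) * ((1 - t) * W \<beta> n)" using t Wpos(1)[OF that] by simp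
      also have "\<dots> \<le> form \<beta> n ?h ?h"
        unfolding form_two_valued2 using t W_nonneg by (simp add: distrib_left)
      finally show ?thesis .
    qed
    show "hyperbolic (idx \<alpha>) ?M"
    proof (rule hyperbolic_local_to_global[where h = ?h and e = None])
      show "symmetric_on (idx \<alpha>) ?M"
        using atlas_sym[OF len] by (simp add: symmetric_on_def)
      show "?M i j \<ge> 0" for i j using t by (simp add: atlas_nonneg)
      show "?h i > 0" for i using t by (cases i) auto
      show "None \<in> idx \<alpha>" by (simp add: idx_def)
      show "?M i None > 0" if "i \<in> idx \<alpha>" for i
        using that t Wpos[of \<alpha>] Wpos[of "\<alpha> @ [_]"] Suc.prems(1)
        by (cases i) (auto simp: idx_def Cont_iff intro!: add_nonneg_pos)
      fix v
      let ?q = "\<lambda>i. ?h i * (mv (idx \<alpha>) ?M v i)\<^sup>2 / mv (idx \<alpha>) ?M ?h i"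
      \<comment> \<open>The value of \<open>?h\<close> at each index is the coefficient of the form
        that its row controls: \<open>1 - t\<close> for level \<open>n\<close> at
        \<open>\<alpha>\<close>, and \<open>t\<close> for the words \<open>\<alpha> @ [x]\<close>.
        Each bound is the reversed Cauchy-Schwarz inequality against \<open>?h\<close>.\<close>
      have None: "(1 - t) * form \<alpha> n v v \<le> ?q None"
      proof -
        have "form \<alpha> n v v * form \<alpha> n ?h ?h \<le> (form \<alpha> n v ?h)\<^sup>2"
          using Suc form_pos[of \<alpha>] by (simp add: hyperbolic_def)
        then have "form \<alpha> n v v \<le> (form \<alpha> n v ?h)\<^sup>2 / form \<alpha> n ?h ?h"
          using form_pos[of \<alpha>] Suc.prems(1) by (simp add: field_simps)
        then have "(1 - t) * form \<alpha> n v v \<le> (1 - t) * ((form \<alpha> n v ?h)\<^sup>2 / form \<alpha> n ?h ?h)"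
          using t by (intro mult_left_mono) auto
        then show ?thesis by (simp add: mv_matrix_linear inheritance_None)
      qed
      have Some: "t * form (\<alpha> @ [x]) n (shift \<alpha> x v) (shift \<alpha> x v) \<le> ?q (Some x)"
        if x: "x \<in> Cont X L \<alpha>" for x
      proof -
        let ?F = "form (\<alpha> @ [x]) n" and ?u = "shift \<alpha> x v"
        have xL: "\<alpha> @ [x] \<in> L" using x by (simp add: Cont_iff)
        have pos: "?F ?h ?h > 0" using xL by (intro form_pos) auto
        then have "?F ?u ?u * ?F ?h ?h \<le> (?F ?u ?h)\<^sup>2"
          using Suc.IH[OF xL] Suc.prems(2) by (simp add: hyperbolic_def)
        then have "?F ?u ?u \<le> (?F ?u ?h)\<^sup>2 / ?F ?h ?h" using pos by (simp add: field_simps)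
        then have "t * ?F ?u ?u \<le> t * ((?F ?u ?h)\<^sup>2 / ?F ?h ?h)"
          using t by (intro mult_left_mono) auto
        then show ?thesis by (simp add: mv_matrix_linear inheritance_Some[OF xL])
      qed
      have "t * form \<alpha> (Suc n) v v \<le> t * (\<Sum>x\<in>X. form (\<alpha> @ [x]) n (shift \<alpha> x v) (shift \<alpha> x v))"
        using t Suc.prems by (intro mult_left_mono pullback) auto
      also have "(\<Sum>x\<in>X. form (\<alpha> @ [x]) n (shift \<alpha> x v) (shift \<alpha> x v)) =
          (\<Sum>x\<in>Cont X L \<alpha>. form (\<alpha> @ [x]) n (shift \<alpha> x v) (shift \<alpha> x v))"
        by (rule sum_Cont[symmetric]) (simp add: form_eq W_outside_prefix W_outside)
      also have "t * \<dots> \<le> (\<Sum>x\<in>Cont X L \<alpha>. ?q (Some x))"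
        unfolding sum_distrib_left by (intro sum_mono Some)
      finally show "bil (idx \<alpha>) ?M v v \<le> (\<Sum>i\<in>idx \<alpha>. ?q i)"
        unfolding bil_matrix_linear sum_idx using None by linarith
    qed (rule finite_idx)
  qed
qed

section \<open>The equality case\<close>

lemma act_two_valued:
  assumes "\<alpha> @ [x] \<in> L"
  shows "act \<alpha> n (two_valued s t) (Some x) = s * W (\<alpha> @ [x]) (Suc n) + t * W (\<alpha> @ [x]) n"
  unfolding act_Some[OF assms] W_Suc by (simp add: sum_distrib_left mult.commute)

text \<open>With \<open>g = two_valued 0 1\<close>, the two equations say that
  \<open>two_valued 1 (- s)\<close> is isotropic and orthogonal to \<open>g\<close>.\<close>

lemma equality_kernel:
  assumes "\<alpha> \<in> L" "length \<alpha> + n < k"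
    and "W \<alpha> (Suc (Suc n)) = s * W \<alpha> (Suc n)" "W \<alpha> (Suc n) = s * W \<alpha> n"
    and "i \<in> idx \<alpha>"
  shows "act \<alpha> n (two_valued 1 (- s)) i = 0"
proof (rule hyperbolic_kernel_mv)
  show "symmetric_on (idx \<alpha>) (atlas \<alpha> n)" using assms(2) by (intro atlas_sym) simp
  show "hyperbolic (idx \<alpha>) (atlas \<alpha> n)" using assms(1,2) by (rule hyperbolic_atlas)
  show "form \<alpha> n (two_valued 0 1) (two_valued 0 1) > 0"
    using assms(1,2) k_less by (simp add: form_two_valued2 W_pos)
qed (use assms in \<open>simp_all add: form_two_valued2 finite_idx\<close>)

text \<open>The kernel rows of the level \<open>n + 1\<close> matrix give the first equation for
  every letter. It makes each form \<open>?F y\<close> nonpositive, while \<open>pullback\<close>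
  makes their sum nonnegative, so each vanishes.\<close>

lemma equality_descends:
  assumes \<alpha>: "\<alpha> \<in> L" "length \<alpha> + n + 2 \<le> k" and x: "\<alpha> @ [x] \<in> L" and s: "s > 0"
    and e1: "W \<alpha> (Suc (Suc (Suc n))) = s * W \<alpha> (Suc (Suc n))"
    and e2: "W \<alpha> (Suc (Suc n)) = s * W \<alpha> (Suc n)"
  shows "W (\<alpha> @ [x]) (Suc (Suc n)) = s * W (\<alpha> @ [x]) (Suc n)"
    "W (\<alpha> @ [x]) (Suc n) = s * W (\<alpha> @ [x]) n"
proof -
  \<comment> \<open>Orthogonality is tested against \<open>?f\<close>, since only the equation
    between the two top levels is known when the sign of \<open>?F\<close> is determined.\<close>
  let ?z = "two_valued 1 (- s)" and ?f = "two_valued 1 0"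
  let ?F = "\<lambda>y. form (\<alpha> @ [y]) n ?z ?z"
  have ker: "W (\<alpha> @ [y]) (Suc (Suc n)) = s * W (\<alpha> @ [y]) (Suc n)" if "\<alpha> @ [y] \<in> L" for y
    using equality_kernel[OF \<alpha>(1) _ e1 e2, of "Some y"] that \<alpha>(2)
    by (simp add: idx_def Cont_iff act_two_valued[unfolded idx_def])
  show first: "W (\<alpha> @ [x]) (Suc (Suc n)) = s * W (\<alpha> @ [x]) (Suc n)" using ker[OF x] .
  have nonpos: "?F y \<le> 0" for y
  proof (cases "\<alpha> @ [y] \<in> L")
    case True
    have "form (\<alpha> @ [y]) n ?f ?f > 0"
      using True \<alpha>(2) k_less by (simp add: form_two_valued2 W_pos)
    moreover have "?F y * form (\<alpha> @ [y]) n ?f ?f \<le> (form (\<alpha> @ [y]) n ?z ?f)\<^sup>2"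
      using hyperbolic_atlas[OF True, of n] \<alpha>(2) calculation by (simp add: hyperbolic_def)
    moreover have "form (\<alpha> @ [y]) n ?z ?f = 0" by (simp add: form_two_valued2 ker[OF True])
    ultimately show ?thesis by (simp add: mult_le_0_iff)
  next
    case False
    then show ?thesis by (simp add: form_two_valued2 W_outside)
  qed
  have "0 = form \<alpha> (Suc n) ?z ?z" by (simp add: form_two_valued2 e1 e2)
  also have "\<dots> \<le> (\<Sum>y\<in>X. ?F y)" using pullback[of \<alpha> n ?z] \<alpha> by simp
  also have "\<dots> = ?F x + (\<Sum>y\<in>X - {x}. ?F y)"
    using subset_ground[OF x] finite_ground by (intro sum.remove) auto
  also have "\<dots> \<le> ?F x + 0" using nonpos by (intro add_left_mono sum_nonpos)
  finally have "?F x = 0" using nonpos[of x] by simp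
  \<comment> \<open>Given the first equation, the form at \<open>?z\<close> is \<open>- s\<close>
    times the difference of the two sides.\<close>
  then show "W (\<alpha> @ [x]) (Suc n) = s * W (\<alpha> @ [x]) n"
    using s first by (simp add: form_two_valued2)
qed

lemma equality_at_words:
  assumes "1 \<le> k" "s > 0" "W [] (k + 1) = s * W [] k" "W [] k = s * W [] (k - 1)"
  shows "\<alpha> \<in> L \<Longrightarrow> length \<alpha> \<le> k - 1 \<Longrightarrow>
    W \<alpha> (k + 1 - length \<alpha>) = s * W \<alpha> (k - length \<alpha>) \<and>
    W \<alpha> (k - length \<alpha>) = s * W \<alpha> (k - 1 - length \<alpha>)"
proof (induction \<alpha> rule: rev_induct)
  case Nil
  then show ?case using assms by simp
next
  case (snoc x \<alpha>)
  \<comment> \<open>The last letter forces \<open>length \<alpha> \<le> k - 2\<close>, so the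
    subtraction of natural numbers is exact.\<close>
  define n where "n = k - 2 - length \<alpha>"
  have \<alpha>: "\<alpha> \<in> L" using hereditary snoc.prems(1) by blast
  have n: "k + 1 - length \<alpha> = Suc (Suc (Suc n))" "k - length \<alpha> = Suc (Suc n)"
    "k - 1 - length \<alpha> = Suc n" "length \<alpha> + n + 2 \<le> k"
    "k + 1 - length (\<alpha> @ [x]) = Suc (Suc n)" "k - length (\<alpha> @ [x]) = Suc n"
    "k - 1 - length (\<alpha> @ [x]) = n"
    using snoc.prems(2) by (auto simp: n_def)
  show ?case
    using equality_descends[OF \<alpha> n(4) snoc.prems(1) assms(2)] snoc.IH[OF \<alpha>] snoc.prems(2)
    unfolding n by simp
qed

section \<open>From single words to level sums\<close>

lemma level_sum_W: "level_sum L q j = W [] j"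
  using words empty_word unfolding level_sum_def cont_level_sum_def Cont_words_def
  by (intro sum.cong) auto

text \<open>Cutting words after \<open>j\<close> letters allows the equations of single words to be
  summed to equations of whole levels.\<close>

lemma level_sum_add:
  "level_sum L q (j + i) = (\<Sum>\<alpha> | \<alpha> \<in> L \<and> length \<alpha> = j. W \<alpha> i)"
proof -
  let ?A = "{\<alpha>. \<alpha> \<in> L \<and> length \<alpha> = j}"
  have prefix: "take j \<gamma> \<in> L" if "\<gamma> \<in> L" for \<gamma>
    using hereditary[of "take j \<gamma>" "drop j \<gamma>"] that by simp
  have fin: "finite (Cont_words X L i \<alpha>)" for \<alpha>
    by (rule finite_subset[OF _ finite_lists_length_eq[OF finite_ground, of i]])
      (auto simp: Cont_words_def)
  have "(\<Sum>\<alpha>\<in>?A. W \<alpha> i) = (\<Sum>(\<alpha>, \<beta>)\<in>Sigma ?A (Cont_words X L i). q (\<alpha> @ \<beta>))"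
    unfolding cont_level_sum_def using finite_language fin by (intro sum.Sigma) auto
  also have "\<dots> = level_sum L q (j + i)"
    unfolding level_sum_def
    by (rule sum.reindex_bij_witness[of _ "\<lambda>\<gamma>. (take j \<gamma>, drop j \<gamma>)" "\<lambda>(\<alpha>, \<beta>). \<alpha> @ \<beta>"])
      (auto simp: Cont_words_def dest: subset_ground in_set_dropD intro: prefix)
  finally show ?thesis by simp
qed

text \<open>Both sides express that \<open>two_valued 1 (- s)\<close> lies in the kernel of the
  level 0 matrix at \<open>\<alpha>\<close>: the extra row is the first equation, the row of
  \<open>x\<close> the equation of its class.\<close>

lemma equality_iff_parallel:
  assumes \<alpha>: "\<alpha> \<in> L" "length \<alpha> = k - 1" and k: "1 \<le> k" and s: "s > 0"
  shows "W \<alpha> 2 = s * W \<alpha> 1 \<and> s * W \<alpha> 1 = s\<^sup>2 * W \<alpha> 0 \<longleftrightarrow>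
    (\<Sum>x\<in>Cont X L \<alpha>. q (\<alpha> @ [x]) / q \<alpha>) = s \<and>
    (\<forall>P\<in>Par X L \<alpha>. (1 - b \<alpha> P) * (\<Sum>x\<in>P. q (\<alpha> @ [x]) / q \<alpha>) =
       s * (1 - (c k)\<^sup>2 / (c (k - 1) * c (k + 1))))"
proof -
  let ?z = "two_valued 1 (- s)" and ?Y = "class_sum \<alpha> (two_valued 1 (- s))"
  let ?S = "?Y (Cont X L \<alpha>)"
  have len: "length \<alpha> < k" "length \<alpha> + 0 < k" "Suc (k - Suc 0) = k"
    using \<alpha>(2) k by auto
  have c: "c (k - 1) > 0" "c k > 0" "c (k + 1) > 0" using c_pos k_less by auto
  have w: "scaled q c \<alpha> > 0" using \<alpha>(1) by (rule scaled_pos)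
  have sum_eq: "(\<Sum>x\<in>P. q (\<alpha> @ [x]) / q \<alpha>) = c k / c (k - 1) * ?Y P" if "P \<subseteq> Cont X L \<alpha>" for P
    unfolding class_sum_def sum_distrib_left
  proof (intro sum.cong refl)
    fix x assume "x \<in> P"
    then have "\<alpha> @ [x] \<in> L" using that by (auto simp: Cont_iff)
    then show "q (\<alpha> @ [x]) / q \<alpha> = c k / c (k - 1) * (ratio \<alpha> x * ?z (Some x))"
      using q_ratio[of \<alpha> x] q_scaled[OF \<alpha>(1)] w by (simp add: len \<alpha>(2))
  qed
  have S: "(\<Sum>x\<in>Cont X L \<alpha>. q (\<alpha> @ [x]) / q \<alpha>) = s \<longleftrightarrow> act \<alpha> 0 ?z None = 0"
    unfolding sum_eq[OF subset_refl] act_base_None[OF \<alpha>(1)] using c w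
    by (auto simp: len \<alpha>(2) field_simps)
  \<comment> \<open>The extra row identifies \<open>s\<close> with a multiple of the total class
    sum, which turns the row of \<open>x\<close> into an equation for its class alone.\<close>
  have P: "(1 - b \<alpha> (parcl \<alpha> x)) * (\<Sum>y\<in>parcl \<alpha> x. q (\<alpha> @ [y]) / q \<alpha>) =
      s * (1 - (c k)\<^sup>2 / (c (k - 1) * c (k + 1))) \<longleftrightarrow> act \<alpha> 0 ?z (Some x) = 0"
    if x: "\<alpha> @ [x] \<in> L" and None: "act \<alpha> 0 ?z None = 0" for x
  proof -
    have sub: "parcl \<alpha> x \<subseteq> Cont X L \<alpha>" by (auto simp: parcl_iff Cont_iff)
    define y where "y = (1 - b \<alpha> (parcl \<alpha> x)) * ?Y (parcl \<alpha> x)"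
    define S where "S = ?S"
    have s_eq: "s = c k / c (k - 1) * S"
      using None w c by (simp add: act_base_None[OF \<alpha>(1)] len \<alpha>(2) S_def field_simps)
    have "act \<alpha> 0 ?z (Some x) = 0 \<longleftrightarrow> c (k + 1) * (S - y) = c k * s"
      unfolding act_base_Some[OF x len(1)] y_def S_def
      using w ratio_pos[OF x] by (simp add: len \<alpha>(2))
    also have "\<dots> \<longleftrightarrow> y = S * (1 - (c k)\<^sup>2 / (c (k - 1) * c (k + 1)))"
      unfolding s_eq using c by (auto simp: field_simps power2_eq_square)
    also have "\<dots> \<longleftrightarrow> c k / c (k - 1) * y = s * (1 - (c k)\<^sup>2 / (c (k - 1) * c (k + 1)))"
      unfolding s_eq using c by (simp add: mult.assoc)
    finally show ?thesis
      unfolding sum_eq[OF sub] y_def by (simp add: mult_ac)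
  qed
  show ?thesis (is "?L \<longleftrightarrow> ?R")
  proof
    assume ?L
    then have e: "W \<alpha> (Suc (Suc 0)) = s * W \<alpha> (Suc 0)" "W \<alpha> (Suc 0) = s * W \<alpha> 0"
      using s by (simp_all add: power2_eq_square numeral_2_eq_2)
    have "act \<alpha> 0 ?z i = 0" if "i \<in> idx \<alpha>" for i
      by (rule equality_kernel[OF \<alpha>(1) len(2) e that])
    then show ?R using S P by (auto simp: Par_eq Cont_iff idx_def)
  next
    assume ?R
    then have None: "act \<alpha> 0 ?z None = 0" using S by simp
    have Some: "act \<alpha> 0 ?z (Some x) = 0" if "x \<in> Cont X L \<alpha>" for x
      using \<open>?R\<close> P[OF _ None, of x] that by (auto simp: Par_eq Cont_iff)
    \<comment> \<open>Conversely, the kernel equations give isotropy; the extra row supplies the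
      equation between levels 0 and 1, isotropy then the one between levels 1 and 2.\<close>
    have "form \<alpha> 0 ?z ?z = 0" unfolding bil_def sum_idx by (simp add: None Some)
    moreover have "act \<alpha> 0 ?z None = W \<alpha> (Suc 0) - s * W \<alpha> 0"
      unfolding act_None W_Suc by simp
    ultimately show ?L
      using None by (simp add: form_two_valued2 power2_eq_square numeral_2_eq_2)
  qed
qed

end

theorem theorem3p3:
  fixes X :: "'a set" and L :: "'a list set" and k m :: nat
    and q :: "'a list \<Rightarrow> real" and c :: "nat \<Rightarrow> real"
  assumes "interval_greedoid X L"
    and "m = rk L"
    and "1 \<le> k" and "k < m"
    and "admissible X L k q c"
  shows "let
      cond_a = (level_sum L q k)\<^sup>2 = level_sum L q (k - 1) * level_sum L q (k + 1);
      cond_b = \<exists>s>0. \<forall>\<alpha>\<in>L. length \<alpha> = k - 1 \<longrightarrow>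
        cont_level_sum X L q \<alpha> 2 = s * cont_level_sum X L q \<alpha> 1 \<and>
        s * cont_level_sum X L q \<alpha> 1 = s\<^sup>2 * cont_level_sum X L q \<alpha> 0;
      cond_c = \<exists>s>0. \<forall>\<alpha>\<in>L. length \<alpha> = k - 1 \<longrightarrow>
        (\<Sum>x\<in>Cont X L \<alpha>. q (\<alpha> @ [x]) / q \<alpha>) = s \<and>
        (\<forall>C\<in>Par X L \<alpha>.
           (1 - par_coeff X L q c \<alpha> C) * (\<Sum>x\<in>C. q (\<alpha> @ [x]) / q \<alpha>) =
           s * (1 - (c k)\<^sup>2 / (c (k - 1) * c (k + 1))))
    in (cond_a \<longleftrightarrow> cond_b) \<and> (cond_b \<longleftrightarrow> cond_c)"
proof -
  interpret admissible_greedoid X L k q c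
    using assms by (simp add: admissible_greedoid_def admissible_greedoid_axioms_def)
  let ?l = "level_sum L q"
  let ?b = "\<lambda>s \<alpha>. W \<alpha> 2 = s * W \<alpha> 1 \<and> s * W \<alpha> 1 = s\<^sup>2 * W \<alpha> 0"
  have ab: "(?l k)\<^sup>2 = ?l (k - 1) * ?l (k + 1) \<longleftrightarrow>
      (\<exists>s>0. \<forall>\<alpha>\<in>L. length \<alpha> = k - 1 \<longrightarrow> ?b s \<alpha>)"
  proof
    assume a: "(?l k)\<^sup>2 = ?l (k - 1) * ?l (k + 1)"
    have pos: "?l (k - 1) > 0" "?l k > 0"
      unfolding level_sum_W using empty_word k_less by (auto intro: W_pos)
    \<comment> \<open>Equality in (a) makes both consecutive quotients of level sums equal to this
      value.\<close>
    define s where "s = ?l k / ?l (k - 1)"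
    have s: "s > 0" using pos by (simp add: s_def)
    have lk: "?l k = s * ?l (k - 1)" using pos by (simp add: s_def)
    have "?l (k + 1) = s * ?l k" using a pos by (simp add: s_def power2_eq_square field_simps)
    note eq = equality_at_words[OF assms(3) s this[unfolded level_sum_W] lk[unfolded level_sum_W]]
    have "?b s \<alpha>" if "\<alpha> \<in> L" "length \<alpha> = k - 1" for \<alpha>
    proof -
      have "k + 1 - (k - 1) = 2" "k - (k - 1) = 1" using assms(3) by auto
      then show ?thesis using eq[OF that(1)] that(2) by (simp add: power2_eq_square)
    qed
    then show "\<exists>s>0. \<forall>\<alpha>\<in>L. length \<alpha> = k - 1 \<longrightarrow> ?b s \<alpha>" using s by blast
  next
    assume "\<exists>s>0. \<forall>\<alpha>\<in>L. length \<alpha> = k - 1 \<longrightarrow> ?b s \<alpha>"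
    then obtain s where s: "s > 0" "\<And>\<alpha>. \<alpha> \<in> L \<Longrightarrow> length \<alpha> = k - 1 \<Longrightarrow> ?b s \<alpha>" by blast
    have k: "k - 1 + 2 = k + 1" "k - 1 + 1 = k" using assms(3) by auto
    have "?l (k + 1) = s * ?l k"
      using s(2) level_sum_add[of "k - 1" 2] level_sum_add[of "k - 1" 1]
      unfolding k by (simp add: sum_distrib_left)
    moreover have "?l k = s * ?l (k - 1)"
      using s level_sum_add[of "k - 1" 1] level_sum_add[of "k - 1" 0]
      unfolding k by (simp add: sum_distrib_left power2_eq_square)
    ultimately show "(?l k)\<^sup>2 = ?l (k - 1) * ?l (k + 1)" by (simp add: power2_eq_square)
  qed
  \<comment> \<open>The equivalence of (b) and (c) holds word by word with the same
    \<open>s\<close>.\<close>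
  show ?thesis
    unfolding Let_def using ab equality_iff_parallel[OF _ _ assms(3)] by (simp cong: conj_cong)
qed

end
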